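(* Let $d\ge 1$, let $K_d=\prod_{j=1}^d[a_j,b_j]\subset\mathbb{R}^d$ be a compact $d$-dimensional interval and let $x_0\in K_d$. Let $(g_n)_{n\ge1}$ and $(W_n)_{n\ge1}$ be independent sequences such that: $(g_n)_{n\ge1}$ is a sequence of independent symmetric complex-valued sub-Gaussian random variables with parameter $1$; $(W_n)_{n\ge1}$ is a sequence of complex-valued continuous random fields on $K_d$ such that for every $x\in K_d$, almost surely $\sum_{n=1}^{+\infty}|W_n(x)|^2<+\infty$. Put $S_N(x)=\sum_{n=1}^N W_n(x)g_n$ for $N\in\mathbb{N}$, $S(x)=\sum_{n=1}^{+\infty}W_n(x)g_n$, and $$s(x,y)=\Big(\sum_{n=1}^{+\infty}|W_n(x)-W_n(y)|^2\Big)^{1/2},\qquad x,y\in K_d.$$ Let $\rho$ be a quasi-metric on $\mathbb{R}^d$ for which there exist $0<\underline{H}\le\overline{H}\le1$ and $c_{2,1},c_{2,2}\in(0,\infty)$ with $c_{2,1}\|x-y\|^{\overline{H}}\le\rho(x,y)\le c_{2,2}\|x-y\|^{\underline{H}}$ for all $x,y\in\mathbb{R}^d$ with $\|x-y\|\le1$. Assume that there exist an almost sure event $\Omega'$ and random variables $\gamma>0$, $\beta\in(0,1]$, $\eta\in\mathbb{R}$ and $C_0\in(0,+\infty)$ such that on $\Omega'$ $$\forall x,y\in B(x_0,\gamma)\cap K_d,\qquad s(x,y)\le C_0\,\rho(x,y)^{\beta}|\log\rho(x,y)|^{\eta}.$$ Then, almost surely, there exist $\gamma^*\in(0,\gamma)$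 and $C\in(0,+\infty)$ such that for all $x,y\in B(x_0,\gamma^* )\cap K_d$, $$\sup_{N\in\mathbb{N}}|S_N(x)-S_N(y)|\le C\rho(x,y)^{\beta}|\log\rho(x,y)|^{\eta+1/2}.$$ Moreover, almost surely $(S_N)_{N\in\mathbb{N}}$ converges uniformly on $B(x_0,\gamma^* )\cap K_d$ to $S$, and the limit $S$ belongs to $\mathcal{H}_{\rho,K_d}(x_0,\beta,\eta+1/2)$. In particular, almost surely $S$ is continuous at $x_0$.
   Context: $\|\cdot\|$ is the Euclidean norm and $B(x_0,\gamma)=\{z:\|z-x_0\|\le\gamma\}$. $\mathbb{N}$ contains $0$ and $\sum_{n=1}^0=0$. A complex-valued random variable $Z$ is sub-Gaussian with parameter $s\in[0,+\infty)$ if $\mathbb{E}(e^{\Re(\overline z Z)})\le e^{s^2|z|^2/2}$ for all $z\in\mathbb{C}$. $Z$ is symmetric if $Z$ and $-Z$ have the same law. Under the hypotheses, for each fixed $x$ the series defining $S(x)$ converges almost surely; $S(x)$ denotes the limit of $S_N(x)$ wherever it exists (and, say, $0$ elsewhere). A quasi-metric on $\mathbb{R}^d$ is a continuous function $\rho:\mathbb{R}^d\times\mathbb{R}^d\to[0,+\infty)$ such that $\rho(x,y)=0$ iff $x=y$, $\rho(x,y)=\rho(y,x)$, and for some constant $\kappa\ge1$, $\rho(x,z)\le\kappa(\rho(x,y)+\rho(y,z))$ for all $x,y,z$. For $\beta\in(0,1]$, $\eta\in\mathbb{R}$, $x_0\in K_d$, a (complex-valued) function $f$ on $K_d$ belongs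 to $\mathcal{H}_{\rho,K_d}(x_0,\beta,\eta)$ if there exist $\gamma\in(0,1)$ and $C\in(0,+\infty)$ such that $|f(x)-f(y)|\le C\rho(x,y)^{\beta}|\log\rho(x,y)|^{\eta}$ for all $x,y\in B(x_0,\gamma)\cap K_d$. By convention $h^\beta|\log h|^\eta=0$ at $h=0$. The event $\Omega'$, the random variables $\gamma,\beta,\eta,C_0$ and $\rho$ may depend on $x_0$. *)

theory Defs
  imports "HOL-Probability.Probability"
begin

definition sub_gaussian :: "'a measure \<Rightarrow> real \<Rightarrow> ('a \<Rightarrow> complex) \<Rightarrow> bool" where
  "sub_gaussian M s Z \<longleftrightarrow>
     0 \<le> s \<and> Z \<in> borel_measurable M \<and>
     (\<forall>z. (\<integral>\<^sup>+\<omega>. ennreal (exp (Re (cnj z * Z \<omega>))) \<partial>M) \<le> ennreal (exp (s\<^sup>2 * (cmod z)\<^sup>2 / 2)))"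

definition symmetric_rv :: "'a measure \<Rightarrow> ('a \<Rightarrow> complex) \<Rightarrow> bool" where
  "symmetric_rv M Z \<longleftrightarrow>
     Z \<in> borel_measurable M \<and> distr M borel Z = distr M borel (\<lambda>\<omega>. - Z \<omega>)"

text \<open>Sample paths are only required to be continuous almost surely, which covers the
  stricter convention that every sample path is continuous.\<close>

definition continuous_random_field ::
    "'a measure \<Rightarrow> 'b::topological_space set \<Rightarrow> ('b \<Rightarrow> 'a \<Rightarrow> complex) \<Rightarrow> bool" where
  "continuous_random_field M K X \<longleftrightarrow>
     (\<forall>x\<in>K. X x \<in> borel_measurable M) \<and> (AE \<omega> in M. continuous_on K (\<lambda>x. X x \<omega>))"

text \<open>Independence of the two whole sequences, i.e. of the sigma-algebras generated by all the
  \<open>g n\<close> and by all the \<open>W n x\<close> with \<open>x \<in> K\<close>. (The library's \<open>indep_var\<close> does not apply, as it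
  needs both variables to take values in the same type.)\<close>

definition indep_sequences ::
    "'a measure \<Rightarrow> 'b set \<Rightarrow> (nat \<Rightarrow> 'a \<Rightarrow> complex) \<Rightarrow> (nat \<Rightarrow> 'b \<Rightarrow> 'a \<Rightarrow> complex) \<Rightarrow> bool" where
  "indep_sequences M K g W \<longleftrightarrow>
     prob_space.indep_set M
       (sigma_sets (space M) {g n -` A \<inter> space M |n A. A \<in> sets borel})
       (sigma_sets (space M) {W n x -` A \<inter> space M |n x A. x \<in> K \<and> A \<in> sets borel})"

text \<open>Sequences are indexed from \<open>0\<close>: \<open>g n\<close> and \<open>W n\<close> stand for the terms of rank \<open>n + 1\<close>,
  so that \<open>partial_sum W g N\<close> is the sum of the first \<open>N\<close> terms.\<close>

definition partial_sum ::
    "(nat \<Rightarrow> 'b \<Rightarrow> 'a \<Rightarrow> complex) \<Rightarrow> (nat \<Rightarrow> 'a \<Rightarrow> complex) \<Rightarrow> nat \<Rightarrow> 'b \<Rightarrow> 'a \<Rightarrow> complex" where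
  "partial_sum W g N x \<omega> = (\<Sum>n<N. W n x \<omega> * g n \<omega>)"

definition series_sum ::
    "(nat \<Rightarrow> 'b \<Rightarrow> 'a \<Rightarrow> complex) \<Rightarrow> (nat \<Rightarrow> 'a \<Rightarrow> complex) \<Rightarrow> 'b \<Rightarrow> 'a \<Rightarrow> complex" where
  "series_sum W g x \<omega> =
     (if convergent (\<lambda>N. partial_sum W g N x \<omega>) then lim (\<lambda>N. partial_sum W g N x \<omega>) else 0)"

text \<open>The quantity \<open>s(x,y)\<close>, with value \<open>\<infinity>\<close> when the series of squares diverges (this may
  happen, since the series is only known to converge almost surely for each fixed point).\<close>

definition s_dist :: "(nat \<Rightarrow> 'b \<Rightarrow> 'a \<Rightarrow> complex) \<Rightarrow> 'b \<Rightarrow> 'b \<Rightarrow> 'a \<Rightarrow> ereal" where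
  "s_dist W x y \<omega> =
     (if summable (\<lambda>n. (cmod (W n x \<omega> - W n y \<omega>))\<^sup>2)
      then ereal (sqrt (\<Sum>n. (cmod (W n x \<omega> - W n y \<omega>))\<^sup>2)) else \<infinity>)"

definition quasi_metric :: "('b::topological_space \<Rightarrow> 'b \<Rightarrow> real) \<Rightarrow> bool" where
  "quasi_metric \<rho> \<longleftrightarrow>
     continuous_on UNIV (\<lambda>(x, y). \<rho> x y) \<and>
     (\<forall>x y. 0 \<le> \<rho> x y) \<and>
     (\<forall>x y. \<rho> x y = 0 \<longleftrightarrow> x = y) \<and>
     (\<forall>x y. \<rho> x y = \<rho> y x) \<and>
     (\<exists>\<kappa>\<ge>1. \<forall>x y z. \<rho> x z \<le> \<kappa> * (\<rho> x y + \<rho> y z))"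

text \<open>The function \<open>h\<^sup>\<beta> |log h|\<^sup>\<eta>\<close> for \<open>h \<ge> 0\<close>, equal to \<open>0\<close> at \<open>h = 0\<close> by convention.
  At \<open>h = 1\<close> the factor is \<open>0\<^sup>\<eta>\<close>, which is \<open>\<infinity>\<close> for \<open>\<eta> < 0\<close> and \<open>1\<close> for \<open>\<eta> = 0\<close>, whereas
  \<open>0 powr \<eta>\<close> would be \<open>0\<close> in all cases.\<close>

definition pow_log :: "real \<Rightarrow> real \<Rightarrow> real \<Rightarrow> ereal" where
  "pow_log \<beta> \<eta> h =
     (if h = 0 then 0
      else if h = 1 then (if \<eta> < 0 then \<infinity> else if \<eta> = 0 then 1 else 0)
      else ereal (h powr \<beta> * \<bar>ln h\<bar> powr \<eta>))"

definition holder_class ::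
    "('b::metric_space \<Rightarrow> 'b \<Rightarrow> real) \<Rightarrow> 'b set \<Rightarrow> 'b \<Rightarrow> real \<Rightarrow> real \<Rightarrow> ('b \<Rightarrow> complex) set" where
  "holder_class \<rho> K x0 \<beta> \<eta> =
     {f. \<exists>\<gamma> C. 0 < \<gamma> \<and> \<gamma> < 1 \<and> 0 < C \<and>
        (\<forall>x\<in>cball x0 \<gamma> \<inter> K. \<forall>y\<in>cball x0 \<gamma> \<inter> K.
           ereal (cmod (f x - f y)) \<le> ereal C * pow_log \<beta> \<eta> (\<rho> x y))}"

end

theory Submission
  imports Defs
begin

text \<open>
  The proof is a chaining argument in which the randomness of the exponents is kept away from the
  exceptional event.

  Suppose first that the coefficients are deterministic. Compensated exponentials of the partial
  sums are supermartingales, so Ville's inequality bounds the supremum over \<open>N\<close> of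
  \<open>\<bar>S\<^sub>N(x) - S\<^sub>N(y)\<bar>\<close> by \<open>sqrt L\<close> times \<open>s(x,y)\<close>, except on an event of probability at most
  \<open>4 * exp (- (L / 4))\<close> (\<open>sub_gaussian_maximal\<close>). Take finite nets \<open>D k\<close> of \<open>K\<close> at the scale \<open>1 / 2 ^ k\<close>
  for the quasi-metric \<open>\<rho>\<close>. As \<open>\<rho>\<close> is bounded by a power of the Euclidean distance, their
  cardinality grows at most exponentially in \<open>k\<close> (\<open>exponential_nets\<close>). With \<open>L\<close> a large multiple of
  \<open>k + 1\<close>, the Borel-Cantelli lemma shows that almost surely, from some level on,
  \<open>\<bar>S\<^sub>N(x) - S\<^sub>N(y)\<bar> \<le> A * sqrt (k + 1) * s(x,y)\<close> for all \<open>N\<close> and all \<open>x\<close>, \<open>y\<close> in two consecutive nets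
  (\<open>sub_gaussian_increments_eventually\<close>). Similarly \<open>S\<^sub>N\<close> converges at all the points of the nets
  (\<open>sub_gaussian_series_Cauchy\<close>). Since \<open>g\<close> is independent of the fields, Fubini's theorem carries both
  facts over to random coefficients (\<open>AE_indep_sequences\<close>).

  The bounds that hold on this almost sure event involve \<open>s\<close>, but not the random variables \<open>\<gamma>\<close>, \<open>\<beta>\<close>,
  \<open>\<eta>\<close>, \<open>C0\<close>, which may depend on \<open>g\<close> and could not be treated as constants after conditioning on the
  fields. On it, and for whatever values they take, the rest is deterministic: inserting the bound on
  \<open>s\<close>, the increment over a link of level \<open>k\<close> is of order \<open>2 powr (- k * \<beta>) * k powr (\<eta> + 1 / 2)\<close>, and
  the sum of these quantities along a chain starting at level \<open>j\<close> is of the order of its first term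
  (\<open>chaining_modulus\<close>). The additional \<open>1 / 2\<close> in the exponent of the logarithm is thus the price of
  controlling exponentially many pairs at each level. The resulting modulus of continuity is uniform
  in \<open>N\<close>. Together with convergence on the nets it yields uniform convergence near \<open>x0\<close>
  (\<open>local_modulus_and_uniform_convergence\<close>), and the limit inherits the modulus.
\<close>

section \<open>A maximal inequality for sums of independent variables\<close>

text \<open>The partial sums of \<open>x\<close>, frozen from the first time at which they are at least \<open>c\<close>. Stopping
inside the recursion keeps the value at time \<open>n\<close> a function of \<open>x 0, \<dots>, x (n - 1)\<close> only, and a
partial sum that reaches the level \<open>c\<close> at some time leaves a trace at every later time.\<close>
primrec stopped_sum :: "real \<Rightarrow> (nat \<Rightarrow> real) \<Rightarrow> nat \<Rightarrow> real" where
  "stopped_sum c x 0 = 0"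
| "stopped_sum c x (Suc n) =
     (if c \<le> stopped_sum c x n then stopped_sum c x n else stopped_sum c x n + x n)"

lemma stopped_sum_cong:
  "(\<And>i. i < n \<Longrightarrow> x i = y i) \<Longrightarrow> stopped_sum c x n = stopped_sum c y n"
  by (induction n) auto

lemma stopped_sum_mono_level: "c \<le> stopped_sum c x m \<Longrightarrow> m \<le> n \<Longrightarrow> c \<le> stopped_sum c x n"
  by (induction n) (auto simp: le_Suc_eq)

lemma stopped_sum_eq_sum:
  "(\<And>m. m < n \<Longrightarrow> stopped_sum c x m < c) \<Longrightarrow> stopped_sum c x n = (\<Sum>i<n. x i)"
proof (induction n)
  case (Suc n)
  have "stopped_sum c x n = (\<Sum>i<n. x i)" using Suc by simp
  moreover have "stopped_sum c x n < c" by (rule Suc.prems) simp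
  ultimately show ?case by simp
qed simp

lemma stopped_sum_reaches_level:
  assumes "c \<le> (\<Sum>i<m. x i)" "m \<le> n"
  shows "c \<le> stopped_sum c x n"
proof (cases "\<exists>k<m. c \<le> stopped_sum c x k")
  case True
  then show ?thesis using assms(2) stopped_sum_mono_level by (meson less_imp_le order_trans)
next
  case False
  then have "stopped_sum c x m = (\<Sum>i<m. x i)"
    by (intro stopped_sum_eq_sum) (auto simp: not_le)
  then show ?thesis using assms stopped_sum_mono_level[of c x m n] by simp
qed

lemma borel_measurable_stopped_sum:
  assumes "\<And>i. i < n \<Longrightarrow> X i \<in> borel_measurable M"
  shows "(\<lambda>\<omega>. stopped_sum c (\<lambda>i. X i \<omega>) n) \<in> borel_measurable M"
  using assms
proof (induction n)
  case (Suc n)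
  then have [measurable]: "(\<lambda>\<omega>. stopped_sum c (\<lambda>i. X i \<omega>) n) \<in> borel_measurable M"
    "X n \<in> borel_measurable M"
    by auto
  show ?case by simp
qed simp

text \<open>The exponentials of the stopped sums form a nonnegative supermartingale. A step multiplies, where
the sum is not yet frozen, a function of the past by \<open>exp (X n)\<close>, which is independent of the past
and has mean at most \<open>1\<close>.\<close>
lemma (in prob_space) nn_integral_exp_stopped_sum_le_1:
  fixes X :: "nat \<Rightarrow> 'a \<Rightarrow> real"
  assumes ind: "indep_vars (\<lambda>_. borel) X UNIV"
    and exp_le: "\<And>n. (\<integral>\<^sup>+\<omega>. ennreal (exp (X n \<omega>)) \<partial>M) \<le> 1"
  shows "(\<integral>\<^sup>+\<omega>. ennreal (exp (stopped_sum c (\<lambda>i. X i \<omega>) n)) \<partial>M) \<le> 1"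
proof (induction n)
  case 0
  show ?case by (simp add: emeasure_space_1)
next
  case (Suc n)
  have [measurable]: "X i \<in> borel_measurable M" for i
    using ind by (auto simp: indep_vars_def)
  define T where "T = (\<lambda>\<omega>. stopped_sum c (\<lambda>i. X i \<omega>) n)"
  \<comment> \<open>\<open>p\<close> cuts the exponential of the stopped sum down to the event that the sum is still moving,
      and \<open>q\<close> below cuts it down to the complement.\<close>
  define p where "p = (\<lambda>t::real. if t < c then ennreal (exp t) else 0)"
  have ind2: "indep_var (PiM {..<n} (\<lambda>_. borel)) (\<lambda>\<omega>. restrict (\<lambda>i. X i \<omega>) {..<n})
                (PiM {n} (\<lambda>_. borel)) (\<lambda>\<omega>. restrict (\<lambda>i. X i \<omega>) {n})"
    by (rule indep_var_restrict[OF ind]) auto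
  have p_meas [measurable]: "p \<in> borel_measurable borel" unfolding p_def by measurable
  have "indep_var borel ((\<lambda>x. p (stopped_sum c x n)) \<circ> (\<lambda>\<omega>. restrict (\<lambda>i. X i \<omega>) {..<n}))
                borel ((\<lambda>x. ennreal (exp (x n))) \<circ> (\<lambda>\<omega>. restrict (\<lambda>i. X i \<omega>) {n}))"
  proof (rule indep_var_compose[OF ind2])
    have [measurable]: "(\<lambda>x. stopped_sum c x n) \<in> borel_measurable (PiM {..<n} (\<lambda>_. borel))"
      by (rule borel_measurable_stopped_sum) (auto intro: measurable_component_singleton)
    show "(\<lambda>x. p (stopped_sum c x n)) \<in> borel_measurable (PiM {..<n} (\<lambda>_. borel))"
      by measurable
    have [measurable]: "(\<lambda>x. x n) \<in> borel_measurable (PiM {n} (\<lambda>_. borel :: real measure))"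
      by (rule measurable_component_singleton) simp
    show "(\<lambda>x. ennreal (exp (x n))) \<in> borel_measurable (PiM {n} (\<lambda>_. borel))"
      by measurable
  qed
  moreover have "(\<lambda>x. p (stopped_sum c x n)) \<circ> (\<lambda>\<omega>. restrict (\<lambda>i. X i \<omega>) {..<n}) = (\<lambda>\<omega>. p (T \<omega>))"
    by (auto simp: T_def fun_eq_iff intro!: arg_cong[where f = p] stopped_sum_cong)
  moreover have "(\<lambda>x. ennreal (exp (x n))) \<circ> (\<lambda>\<omega>. restrict (\<lambda>i. X i \<omega>) {n})
      = (\<lambda>\<omega>. ennreal (exp (X n \<omega>)))"
    by (auto simp: fun_eq_iff)
  ultimately have iv: "indep_var borel (\<lambda>\<omega>. p (T \<omega>)) borel (\<lambda>\<omega>. ennreal (exp (X n \<omega>)))"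
    by simp
  have prod_le: "(\<integral>\<^sup>+\<omega>. p (T \<omega>) * ennreal (exp (X n \<omega>)) \<partial>M) \<le> (\<integral>\<^sup>+\<omega>. p (T \<omega>) \<partial>M)"
  proof -
    have "indep_vars (\<lambda>_. borel)
        (case_bool (\<lambda>\<omega>. p (T \<omega>)) (\<lambda>\<omega>. ennreal (exp (X n \<omega>)))) UNIV"
    proof -
      have "case_bool borel borel = (\<lambda>_. borel :: ennreal measure)"
        by (auto simp: fun_eq_iff split: bool.split)
      then show ?thesis using iv by (simp add: indep_var_def)
    qed
    from indep_vars_nn_integral[OF _ this]
    have "(\<integral>\<^sup>+\<omega>. p (T \<omega>) * ennreal (exp (X n \<omega>)) \<partial>M)
        = (\<integral>\<^sup>+\<omega>. p (T \<omega>) \<partial>M) * (\<integral>\<^sup>+\<omega>. ennreal (exp (X n \<omega>)) \<partial>M)"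
      by (simp add: UNIV_bool mult.commute)
    also have "\<dots> \<le> (\<integral>\<^sup>+\<omega>. p (T \<omega>) \<partial>M) * 1"
      by (intro mult_left_mono exp_le) simp
    finally show ?thesis by simp
  qed
  have [measurable]: "T \<in> borel_measurable M"
    unfolding T_def by (rule borel_measurable_stopped_sum) simp
  define q where "q = (\<lambda>t::real. if t < c then 0 else ennreal (exp t))"
  have [measurable]: "q \<in> borel_measurable borel" unfolding q_def by measurable
  have "(\<integral>\<^sup>+\<omega>. ennreal (exp (stopped_sum c (\<lambda>i. X i \<omega>) (Suc n))) \<partial>M)
      = (\<integral>\<^sup>+\<omega>. q (T \<omega>) + p (T \<omega>) * ennreal (exp (X n \<omega>)) \<partial>M)"
    by (intro nn_integral_cong)
       (auto simp: T_def p_def q_def exp_add ennreal_mult)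
  also have "\<dots> = (\<integral>\<^sup>+\<omega>. q (T \<omega>) \<partial>M) + (\<integral>\<^sup>+\<omega>. p (T \<omega>) * ennreal (exp (X n \<omega>)) \<partial>M)"
    by (intro nn_integral_add) measurable
  also have "\<dots> \<le> (\<integral>\<^sup>+\<omega>. q (T \<omega>) \<partial>M) + (\<integral>\<^sup>+\<omega>. p (T \<omega>) \<partial>M)"
    by (intro add_left_mono prod_le)
  also have "\<dots> = (\<integral>\<^sup>+\<omega>. q (T \<omega>) + p (T \<omega>) \<partial>M)"
    by (intro nn_integral_add[symmetric]) measurable
  also have "\<dots> = (\<integral>\<^sup>+\<omega>. ennreal (exp (stopped_sum c (\<lambda>i. X i \<omega>) n)) \<partial>M)"
    by (intro nn_integral_cong) (auto simp: T_def p_def q_def)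
  also have "\<dots> \<le> 1" by (rule Suc.IH)
  finally show ?case .
qed

text \<open>Ville's inequality. Where a partial sum reaches \<open>c\<close> by time \<open>m\<close>, the stopped sum at time \<open>m\<close> is at
least \<open>c\<close>, so Markov's inequality for its exponential gives the bound for each finite horizon, and
the horizon does not enter it.\<close>
lemma (in prob_space) prob_partial_sums_reach_level:
  fixes X :: "nat \<Rightarrow> 'a \<Rightarrow> real"
  assumes ind: "indep_vars (\<lambda>_. borel) X UNIV"
    and exp_le: "\<And>n. (\<integral>\<^sup>+\<omega>. ennreal (exp (X n \<omega>)) \<partial>M) \<le> 1"
  shows "prob {\<omega>\<in>space M. \<exists>N. c \<le> (\<Sum>n<N. X n \<omega>)} \<le> exp (- c)"
proof -
  have [measurable]: "X i \<in> borel_measurable M" for i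
    using ind by (auto simp: indep_vars_def)
  define F where "F m = {\<omega>\<in>space M. \<exists>N\<le>m. c \<le> (\<Sum>n<N. X n \<omega>)}" for m
  have F_meas [measurable]: "F m \<in> events" for m unfolding F_def by measurable
  have F_le: "prob (F m) \<le> exp (- c)" for m
  proof -
    have "emeasure M (F m) = (\<integral>\<^sup>+\<omega>. indicator (F m) \<omega> \<partial>M)" by simp
    also have "\<dots> \<le> (\<integral>\<^sup>+\<omega>. ennreal (exp (- c)) * ennreal (exp (stopped_sum c (\<lambda>i. X i \<omega>) m)) \<partial>M)"
    proof (intro nn_integral_mono)
      fix \<omega> assume "\<omega> \<in> space M"
      show "indicator (F m) \<omega>
          \<le> ennreal (exp (- c)) * ennreal (exp (stopped_sum c (\<lambda>i. X i \<omega>) m))"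
      proof (cases "\<omega> \<in> F m")
        case True
        then have "c \<le> stopped_sum c (\<lambda>i. X i \<omega>) m"
          unfolding F_def using stopped_sum_reaches_level by blast
        then have "1 \<le> exp (- c) * exp (stopped_sum c (\<lambda>i. X i \<omega>) m)"
          by (simp flip: exp_add)
        then show ?thesis using True by (simp flip: ennreal_mult add: ennreal_le_iff2)
      qed simp
    qed
    also have "\<dots> = ennreal (exp (- c)) * (\<integral>\<^sup>+\<omega>. ennreal (exp (stopped_sum c (\<lambda>i. X i \<omega>) m)) \<partial>M)"
    proof (rule nn_integral_cmult)
      have [measurable]: "(\<lambda>\<omega>. stopped_sum c (\<lambda>i. X i \<omega>) m) \<in> borel_measurable M"
        by (rule borel_measurable_stopped_sum) simp
      show "(\<lambda>\<omega>. ennreal (exp (stopped_sum c (\<lambda>i. X i \<omega>) m))) \<in> borel_measurable M"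
        by measurable
    qed
    also have "\<dots> \<le> ennreal (exp (- c)) * 1"
      by (intro mult_left_mono nn_integral_exp_stopped_sum_le_1 ind exp_le) simp
    finally show ?thesis by (simp add: emeasure_eq_measure)
  qed
  have "incseq F" unfolding F_def incseq_def by (auto intro: order_trans)
  then have "(\<lambda>m. prob (F m)) \<longlonglongrightarrow> prob (\<Union>m. F m)"
    by (intro finite_Lim_measure_incseq) auto
  then have "prob (\<Union>m. F m) \<le> exp (- c)"
    by (rule LIMSEQ_le_const2) (use F_le in auto)
  also have "(\<Union>m. F m) = {\<omega>\<in>space M. \<exists>N. c \<le> (\<Sum>n<N. X n \<omega>)}"
    unfolding F_def by auto
  finally show ?thesis .
qed

section \<open>Sub-Gaussian series with deterministic coefficients\<close>

text \<open>The sub-Gaussian condition at \<open>z = cnj (t * v n)\<close> says that \<open>exp (t * Re (v n * g n))\<close>, divided by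
\<open>exp (t\<^sup>2 * (cmod (v n))\<^sup>2 / 2)\<close>, has mean at most \<open>1\<close>. Over all terms these compensators add up to
at most \<open>t\<^sup>2 * \<sigma>\<^sup>2 / 2\<close>, so Ville's inequality controls all the partial sums at once.\<close>
lemma (in prob_space) sub_gaussian_Re_maximal:
  fixes v :: "nat \<Rightarrow> complex"
  assumes ind: "indep_vars (\<lambda>_. borel) g UNIV"
    and sub: "\<And>n. sub_gaussian M 1 (g n)"
    and summ: "summable (\<lambda>n. (cmod (v n))\<^sup>2)"
    and \<sigma>: "\<sigma> > 0" "\<sigma>\<^sup>2 = (\<Sum>n. (cmod (v n))\<^sup>2)"
    and l: "0 \<le> l"
  shows "prob {\<omega>\<in>space M. \<exists>N. l * \<sigma> \<le> Re (\<Sum>n<N. v n * g n \<omega>)} \<le> exp (- (l\<^sup>2 / 2))"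
proof -
  have [measurable]: "g i \<in> borel_measurable M" for i
    using ind by (auto simp: indep_vars_def)
  \<comment> \<open>The choice that maximises the exponent \<open>t * l * \<sigma> - t\<^sup>2 * \<sigma>\<^sup>2 / 2\<close>, with maximum \<open>l\<^sup>2 / 2\<close>.\<close>
  define t where "t = l / \<sigma>"
  have t: "0 \<le> t" "t * \<sigma> = l" using \<sigma> l by (auto simp: t_def)
  define X where "X n \<omega> = t * Re (v n * g n \<omega>) - t\<^sup>2 * (cmod (v n))\<^sup>2 / 2" for n \<omega>
  have "indep_vars (\<lambda>_. borel) X UNIV"
    using indep_vars_compose2[OF ind, of "\<lambda>n z. t * Re (v n * z) - t\<^sup>2 * (cmod (v n))\<^sup>2 / 2" "\<lambda>_. borel"]
    by (simp add: X_def[abs_def])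
  moreover have "(\<integral>\<^sup>+\<omega>. ennreal (exp (X n \<omega>)) \<partial>M) \<le> 1" for n
  proof -
    define z where "z = cnj (of_real t * v n)"
    let ?e = "exp (- (t\<^sup>2 * (cmod (v n))\<^sup>2 / 2))"
    have "(\<integral>\<^sup>+\<omega>. ennreal (exp (X n \<omega>)) \<partial>M)
        = (\<integral>\<^sup>+\<omega>. ennreal ?e * ennreal (exp (Re (cnj z * g n \<omega>))) \<partial>M)"
      by (intro nn_integral_cong)
         (simp add: X_def z_def mult.assoc flip: ennreal_mult exp_add)
    also have "\<dots> = ennreal ?e * (\<integral>\<^sup>+\<omega>. ennreal (exp (Re (cnj z * g n \<omega>))) \<partial>M)"
      by (intro nn_integral_cmult) measurable
    also have "\<dots> \<le> ennreal ?e * ennreal (exp (1\<^sup>2 * (cmod z)\<^sup>2 / 2))"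
      using sub[of n] by (intro mult_left_mono) (auto simp: sub_gaussian_def)
    also have "\<dots> = 1"
      by (simp add: z_def norm_mult power_mult_distrib flip: ennreal_mult exp_add)
    finally show ?thesis .
  qed
  ultimately have le: "prob {\<omega>\<in>space M. \<exists>N. l\<^sup>2 / 2 \<le> (\<Sum>n<N. X n \<omega>)} \<le> exp (- (l\<^sup>2 / 2))"
    by (rule prob_partial_sums_reach_level)
  have [measurable]: "X n \<in> borel_measurable M" for n unfolding X_def by measurable
  have "prob {\<omega>\<in>space M. \<exists>N. l * \<sigma> \<le> Re (\<Sum>n<N. v n * g n \<omega>)}
      \<le> prob {\<omega>\<in>space M. \<exists>N. l\<^sup>2 / 2 \<le> (\<Sum>n<N. X n \<omega>)}"
  proof (intro finite_measure_mono)
    have "l\<^sup>2 / 2 \<le> (\<Sum>n<N. X n \<omega>)" if "l * \<sigma> \<le> Re (\<Sum>n<N. v n * g n \<omega>)" for N \<omega>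
    proof -
      have "(\<Sum>n<N. (cmod (v n))\<^sup>2) \<le> \<sigma>\<^sup>2"
        unfolding \<sigma>(2) by (rule sum_le_suminf[OF summ]) auto
      then have "t\<^sup>2 * (\<Sum>n<N. (cmod (v n))\<^sup>2) \<le> t\<^sup>2 * \<sigma>\<^sup>2"
        by (rule mult_left_mono) simp
      also have "\<dots> = l\<^sup>2" using t by (simp flip: power_mult_distrib)
      finally have 1: "t\<^sup>2 * (\<Sum>n<N. (cmod (v n))\<^sup>2) \<le> l\<^sup>2" .
      have "l\<^sup>2 = t * (l * \<sigma>)" using t by (simp add: power2_eq_square)
      also have "\<dots> \<le> t * Re (\<Sum>n<N. v n * g n \<omega>)" by (rule mult_left_mono[OF that t(1)])
      finally have 2: "l\<^sup>2 \<le> t * Re (\<Sum>n<N. v n * g n \<omega>)" .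
      have "(\<Sum>n<N. X n \<omega>)
          = t * Re (\<Sum>n<N. v n * g n \<omega>) - t\<^sup>2 * (\<Sum>n<N. (cmod (v n))\<^sup>2) / 2"
        unfolding X_def Re_sum
        by (simp add: sum_subtractf sum_distrib_left sum_divide_distrib del: times_complex.sel)
      then show ?thesis using 1 2 by simp
    qed
    then show "{\<omega>\<in>space M. \<exists>N. l * \<sigma> \<le> Re (\<Sum>n<N. v n * g n \<omega>)}
        \<subseteq> {\<omega>\<in>space M. \<exists>N. l\<^sup>2 / 2 \<le> (\<Sum>n<N. X n \<omega>)}" by blast
  qed measurable
  with le show ?thesis by simp
qed

text \<open>A complex number of modulus greater than \<open>r\<close> has a real or an imaginary part of absolute value at
least \<open>r / sqrt 2\<close>. Multiplying the coefficients by one of \<open>1\<close>, \<open>-1\<close>, \<open>\<i>\<close>, \<open>-\<i>\<close> thus reduces the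
modulus to the real part, at the price of a factor \<open>4\<close>.\<close>
lemma (in prob_space) sub_gaussian_maximal:
  fixes v :: "nat \<Rightarrow> complex"
  assumes ind: "indep_vars (\<lambda>_. borel) g UNIV"
    and sub: "\<And>n. sub_gaussian M 1 (g n)"
    and summ: "summable (\<lambda>n. (cmod (v n))\<^sup>2)"
    and L: "0 \<le> L"
  shows "prob {\<omega>\<in>space M. \<exists>N. L * (\<Sum>n. (cmod (v n))\<^sup>2) < (cmod (\<Sum>n<N. v n * g n \<omega>))\<^sup>2}
    \<le> 4 * exp (- (L / 4))"
proof (cases "(\<Sum>n. (cmod (v n))\<^sup>2) = 0")
  case True
  then have "v n = 0" for n
    using suminf_eq_zero_iff[OF summ] by simp
  then show ?thesis by simp
next
  case False
  have [measurable]: "g i \<in> borel_measurable M" for i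
    using ind by (auto simp: indep_vars_def)
  define \<sigma> where "\<sigma> = sqrt (\<Sum>n. (cmod (v n))\<^sup>2)"
  have nonneg: "0 \<le> (\<Sum>n. (cmod (v n))\<^sup>2)" by (rule suminf_nonneg[OF summ]) simp
  then have \<sigma>: "\<sigma> > 0" "\<sigma>\<^sup>2 = (\<Sum>n. (cmod (v n))\<^sup>2)" using False by (auto simp: \<sigma>_def)
  define l where "l = sqrt (L / 2)"
  have l: "0 \<le> l" "l\<^sup>2 / 2 = L / 4" using L by (auto simp: l_def)
  define E where "E u = {\<omega>\<in>space M. \<exists>N. l * \<sigma> \<le> Re (\<Sum>n<N. (u * v n) * g n \<omega>)}" for u
  let ?U = "{1, - 1, \<i>, - \<i>}"
  have [measurable]: "E u \<in> events" for u unfolding E_def by measurable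
  have E_le: "prob (E u) \<le> exp (- (L / 4))" if "u \<in> ?U" for u
  proof -
    have "cmod u = 1" using that by auto
    then have "(\<lambda>n. (cmod (u * v n))\<^sup>2) = (\<lambda>n. (cmod (v n))\<^sup>2)" by (simp add: norm_mult)
    then show ?thesis
      unfolding E_def l(2)[symmetric]
      by (intro sub_gaussian_Re_maximal ind sub \<sigma> l(1)) (simp_all add: summ \<sigma>)
  qed
  have "prob {\<omega>\<in>space M. \<exists>N. L * (\<Sum>n. (cmod (v n))\<^sup>2) < (cmod (\<Sum>n<N. v n * g n \<omega>))\<^sup>2}
      \<le> prob (\<Union>u\<in>?U. E u)"
  proof (intro finite_measure_mono subsetI)
    fix \<omega> assume "\<omega> \<in> {\<omega>\<in>space M. \<exists>N. L * (\<Sum>n. (cmod (v n))\<^sup>2) < (cmod (\<Sum>n<N. v n * g n \<omega>))\<^sup>2}"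
    then obtain N where \<omega>: "\<omega> \<in> space M"
      and N: "L * (\<Sum>n. (cmod (v n))\<^sup>2) < (cmod (\<Sum>n<N. v n * g n \<omega>))\<^sup>2" by blast
    define z where "z = (\<Sum>n<N. v n * g n \<omega>)"
    have uz: "(\<Sum>n<N. (u * v n) * g n \<omega>) = u * z" for u
      by (simp add: z_def sum_distrib_left mult.assoc)
    have "2 * (l * \<sigma>)\<^sup>2 = L * (\<Sum>n. (cmod (v n))\<^sup>2)"
      using l(2) by (simp only: power_mult_distrib \<sigma>(2)) simp
    also have "\<dots> < (Re z)\<^sup>2 + (Im z)\<^sup>2"
      using N unfolding z_def[symmetric] cmod_power2[of z] .
    finally have "2 * (l * \<sigma>)\<^sup>2 < (Re z)\<^sup>2 + (Im z)\<^sup>2" .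
    then have "(l * \<sigma>)\<^sup>2 \<le> (Re z)\<^sup>2 \<or> (l * \<sigma>)\<^sup>2 \<le> (Im z)\<^sup>2" by linarith
    then have "l * \<sigma> \<le> \<bar>Re z\<bar> \<or> l * \<sigma> \<le> \<bar>Im z\<bar>"
      by (metis abs_ge_self abs_le_square_iff order_trans)
    then have "\<exists>u\<in>?U. l * \<sigma> \<le> Re (u * z)" by (auto simp: abs_if split: if_splits)
    then show "\<omega> \<in> (\<Union>u\<in>?U. E u)" using \<omega> unfolding E_def uz[symmetric] by blast
  qed (intro sets.finite_UN, auto)
  also have "\<dots> \<le> (\<Sum>u\<in>?U. prob (E u))" by (rule finite_measure_subadditive_finite) auto
  also have "\<dots> \<le> (\<Sum>u\<in>?U. exp (- (L / 4)))" by (rule sum_mono) (rule E_le)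
  also have "\<dots> = 4 * exp (- (L / 4))" by (simp add: complex_eq_iff)
  finally show ?thesis .
qed

text \<open>The oscillation of the partial sums after rank \<open>m\<close> is governed by the maximal inequality for the
coefficients with the first \<open>m\<close> of them set to \<open>0\<close>, whose sum of squares tends to \<open>0\<close>. Hence an
oscillation that stays above a fixed size has probability at most \<open>4 * exp (- (L / 4))\<close> for every
\<open>L\<close>.\<close>
lemma (in prob_space) sub_gaussian_series_Cauchy:
  fixes v :: "nat \<Rightarrow> complex"
  assumes ind: "indep_vars (\<lambda>_. borel) g UNIV"
    and sub: "\<And>n. sub_gaussian M 1 (g n)"
    and summ: "summable (\<lambda>n. (cmod (v n))\<^sup>2)"
  shows "AE \<omega> in M. Cauchy (\<lambda>N. \<Sum>n<N. v n * g n \<omega>)"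
proof -
  have [measurable]: "g i \<in> borel_measurable M" for i
    using ind by (auto simp: indep_vars_def)
  define S where "S N \<omega> = (\<Sum>n<N. v n * g n \<omega>)" for N \<omega>
  have [measurable]: "S N \<in> borel_measurable M" for N unfolding S_def by measurable
  define B where "B e = {\<omega>\<in>space M. \<forall>m. \<exists>N\<ge>m. e < (cmod (S N \<omega> - S m \<omega>))\<^sup>2}" for e
  have [measurable]: "B e \<in> events" for e unfolding B_def by measurable
  have B_le: "prob (B e) \<le> 4 * exp (- (L / 4))" if "e > 0" "L \<ge> 0" for e L :: real
  proof -
    define \<tau> where "\<tau> m = (\<Sum>n. (cmod (v (n + m)))\<^sup>2)" for m
    have "\<tau> \<longlonglongrightarrow> 0" unfolding \<tau>_def using suminf_exist_split2[OF summ] by simp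
    then have "(\<lambda>m. L * \<tau> m) \<longlonglongrightarrow> L * 0" by (intro tendsto_mult tendsto_const)
    then have "eventually (\<lambda>m. L * \<tau> m < e) sequentially"
      using \<open>e > 0\<close> by (intro order_tendstoD(2)[of _ "L * 0"]) auto
    then obtain m where m: "L * \<tau> m < e" by (auto simp: eventually_sequentially)
    define v' where "v' n = (if n < m then 0 else v n)" for n
    have v'_sums: "(\<lambda>n. (cmod (v' n))\<^sup>2) sums \<tau> m"
    proof -
      have "(\<lambda>n. (cmod (v' (n + m)))\<^sup>2) sums \<tau> m"
        unfolding v'_def \<tau>_def using summable_ignore_initial_segment[OF summ, of m]
        by (simp add: summable_sums)
      then show ?thesis by (subst (asm) sums_iff_shift) (simp add: v'_def)
    qed
    have S_diff: "S N \<omega> - S m \<omega> = (\<Sum>n<N. v' n * g n \<omega>)" if "m \<le> N" for N \<omega>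
    proof -
      have "{..<N} = {..<m} \<union> {m..<N}" using that by auto
      then have "S N \<omega> - S m \<omega> = (\<Sum>n\<in>{m..<N}. v n * g n \<omega>)"
        unfolding S_def by (simp add: sum.union_disjoint ivl_disj_int)
      also have "\<dots> = (\<Sum>n\<in>{m..<N}. v' n * g n \<omega>)" by (intro sum.cong) (auto simp: v'_def)
      also have "\<dots> = (\<Sum>n<N. v' n * g n \<omega>)"
        by (rule sum.mono_neutral_left) (auto simp: v'_def)
      finally show ?thesis .
    qed
    have "prob (B e) \<le> prob {\<omega>\<in>space M. \<exists>N. L * (\<Sum>n. (cmod (v' n))\<^sup>2) < (cmod (\<Sum>n<N. v' n * g n \<omega>))\<^sup>2}"
    proof (intro finite_measure_mono subsetI)
      fix \<omega> assume "\<omega> \<in> B e"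
      then obtain N where "m \<le> N" "e < (cmod (S N \<omega> - S m \<omega>))\<^sup>2" "\<omega> \<in> space M"
        unfolding B_def by blast
      then show "\<omega> \<in> {\<omega>\<in>space M. \<exists>N. L * (\<Sum>n. (cmod (v' n))\<^sup>2) < (cmod (\<Sum>n<N. v' n * g n \<omega>))\<^sup>2}"
        using m S_diff[of N \<omega>] sums_unique[OF v'_sums] by (auto intro!: exI[of _ N])
    qed measurable
    also have "\<dots> \<le> 4 * exp (- (L / 4))"
      by (rule sub_gaussian_maximal[OF ind sub sums_summable[OF v'_sums] \<open>L \<ge> 0\<close>])
    finally show ?thesis .
  qed
  have "prob (B e) = 0" if "e > 0" for e
  proof -
    have "((\<lambda>L::real. 4 * exp (- (L / 4))) \<longlongrightarrow> 0) at_top" by real_asymp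
    then have "prob (B e) \<le> 0"
      by (rule tendsto_lowerbound)
         (use B_le[OF that] in \<open>auto intro: eventually_at_top_linorderI[of 0]\<close>)
    then show ?thesis by (simp add: measure_le_0_iff)
  qed
  then have "AE \<omega> in M. \<omega> \<notin> B ((1 / Suc k)\<^sup>2)" for k
    by (intro AE_not_in) (simp add: null_sets_def emeasure_eq_measure)
  then have "AE \<omega> in M. \<forall>k. \<omega> \<notin> B ((1 / Suc k)\<^sup>2)" by (simp add: AE_all_countable)
  then show ?thesis
  proof (rule AE_mp, intro AE_I2 impI)
    fix \<omega> assume \<omega>: "\<omega> \<in> space M" and notB: "\<forall>k. \<omega> \<notin> B ((1 / Suc k)\<^sup>2)"
    have "\<exists>m. \<forall>N\<ge>m. dist (S N \<omega>) (S m \<omega>) < e" if "e > 0" for e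
    proof -
      obtain k where k: "1 / Suc k < e" using nat_approx_posE[OF \<open>e > 0\<close>] by blast
      obtain m where m: "(cmod (S N \<omega> - S m \<omega>))\<^sup>2 \<le> (1 / Suc k)\<^sup>2" if "N \<ge> m" for N
        using notB \<omega> unfolding B_def by (auto simp: not_less)
      have "dist (S N \<omega>) (S m \<omega>) < e" if "N \<ge> m" for N
        using power2_le_imp_le[OF m[OF that]] k by (simp add: dist_norm)
      then show ?thesis by blast
    qed
    then show "Cauchy (\<lambda>N. \<Sum>n<N. v n * g n \<omega>)"
      unfolding Cauchy_altdef2 S_def by blast
  qed
qed

text \<open>At level \<open>k\<close> there are at most \<open>B ^ (2 * (k + 1))\<close> pairs of points. A threshold
\<open>L = (4 + 8 * ln B) * (k + 1)\<close> makes each of them fail with probability at most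
\<open>4 * exp (- (L / 4)) = 4 * exp (- (k + 1)) * B ^ (- 2 * (k + 1))\<close>, so that the total failure
probabilities of the levels are summable and the Borel-Cantelli lemma applies. The factor \<open>k + 1\<close>
in the threshold is what produces the additional square root of the logarithm in the modulus of
continuity.\<close>
lemma (in prob_space) sub_gaussian_increments_eventually:
  fixes w :: "nat \<Rightarrow> 'b \<Rightarrow> complex" and D :: "nat \<Rightarrow> 'b set"
  assumes ind: "indep_vars (\<lambda>_. borel) g UNIV"
    and sub: "\<And>n. sub_gaussian M 1 (g n)"
    and fin: "\<And>k. finite (D k)" and card: "\<And>k. real (card (D k)) \<le> B ^ Suc k" and B: "B \<ge> 1"
    and summ: "\<And>k x y. x \<in> D k \<Longrightarrow> y \<in> D k \<Longrightarrow> summable (\<lambda>n. (cmod (w n x - w n y))\<^sup>2)"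
  shows "AE \<omega> in M. eventually (\<lambda>k. \<forall>x\<in>D k. \<forall>y\<in>D k. \<forall>N.
      (cmod (\<Sum>n<N. (w n x - w n y) * g n \<omega>))\<^sup>2
        \<le> (4 + 8 * ln B) * Suc k * (\<Sum>n. (cmod (w n x - w n y))\<^sup>2)) sequentially"
proof -
  have [measurable]: "g i \<in> borel_measurable M" for i
    using ind by (auto simp: indep_vars_def)
  define L where "L k = (4 + 8 * ln B) * Suc k" for k :: nat
  define E where "E k x y = {\<omega>\<in>space M. \<exists>N. L k * (\<Sum>n. (cmod (w n x - w n y))\<^sup>2)
      < (cmod (\<Sum>n<N. (w n x - w n y) * g n \<omega>))\<^sup>2}" for k x y
  define F where "F k = (\<Union>(x, y)\<in>D k \<times> D k. E k x y)" for k
  have E_meas [measurable]: "E k x y \<in> events" for k x y unfolding E_def by measurable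
  have F_meas: "F k \<in> events" for k unfolding F_def
    by (intro sets.finite_UN) (auto intro: fin)
  have F_le: "norm (prob (F k)) \<le> 4 * exp (- 1) ^ Suc k" for k
  proof -
    have "prob (F k) \<le> (\<Sum>(x, y)\<in>D k \<times> D k. prob (E k x y))"
      unfolding F_def case_prod_unfold
      by (rule finite_measure_subadditive_finite) (auto intro: fin)
    also have "\<dots> \<le> (\<Sum>(x, y)\<in>D k \<times> D k. 4 * exp (- (L k / 4)))"
      unfolding E_def L_def using B
      by (intro sum_mono) (auto intro!: sub_gaussian_maximal ind sub summ)
    also have "\<dots> = real (card (D k)) * real (card (D k)) * (4 * exp (- (L k / 4)))"
      by (simp add: card_cartesian_product)
    also have "\<dots> \<le> B ^ Suc k * B ^ Suc k * (4 * exp (- (L k / 4)))"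
      using B by (intro mult_right_mono mult_mono card) auto
    also have "\<dots> = 4 * exp (- 1) ^ Suc k"
    proof -
      define n where "n = real (Suc k)"
      have "exp (n * ln B) = B ^ Suc k"
        unfolding n_def exp_of_nat_mult using B by simp
      moreover have "exp (n * (- 1)) = exp (- 1) ^ Suc k"
        unfolding n_def by (rule exp_of_nat_mult)
      moreover have "exp (n * ln B) * exp (n * ln B) * (4 * exp (- (L k / 4)))
          = 4 * exp (n * ln B + n * ln B + - (L k / 4))"
        unfolding exp_add by simp
      moreover have "n * ln B + n * ln B + - (L k / 4) = n * (- 1)"
        unfolding L_def n_def by algebra
      ultimately show ?thesis by simp
    qed
    finally show ?thesis by (simp only: real_norm_def abs_of_nonneg measure_nonneg)
  qed
  have "summable (\<lambda>k. 4 * exp (- 1 :: real) ^ Suc k)"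
    by (intro summable_mult summable_Suc_iff[THEN iffD2] summable_geometric) simp
  then have "summable (\<lambda>k. prob (F k))"
    by (rule summable_comparison_test') (rule F_le)
  then have "AE \<omega> in M. eventually (\<lambda>k. \<omega> \<in> space M - F k) sequentially"
    by (intro borel_cantelli_AE1 F_meas) (simp_all add: emeasure_eq_measure)
  then show ?thesis
  proof (rule AE_mp, intro AE_I2 impI)
    fix \<omega> assume "eventually (\<lambda>k. \<omega> \<in> space M - F k) sequentially"
    then show "eventually (\<lambda>k. \<forall>x\<in>D k. \<forall>y\<in>D k. \<forall>N.
      (cmod (\<Sum>n<N. (w n x - w n y) * g n \<omega>))\<^sup>2
        \<le> (4 + 8 * ln B) * Suc k * (\<Sum>n. (cmod (w n x - w n y))\<^sup>2)) sequentially"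
      by (rule eventually_mono) (auto simp: F_def E_def L_def not_less[symmetric])
  qed
qed

section \<open>Independent sequences and Fubini's theorem\<close>

text \<open>Since \<open>g\<close> is independent of \<open>F\<close>, the joint law of the identity, seen as a random element of \<open>F\<close>, and
of \<open>g\<close> is a product measure. By Fubini's theorem, a measurable property of the pair then holds
almost surely as soon as it does when the first argument of \<open>P\<close> is kept fixed.\<close>
lemma (in prob_space) AE_independent_substitution:
  assumes F: "subalgebra M F" and g [measurable]: "g \<in> measurable M N"
    and ind: "\<And>A B. A \<in> sets F \<Longrightarrow> B \<in> sets N \<Longrightarrow>
      prob (A \<inter> (g -` B \<inter> space M)) = prob A * prob (g -` B \<inter> space M)"
    and meas: "{p\<in>space (F \<Otimes>\<^sub>M N). P (fst p) (snd p)} \<in> sets (F \<Otimes>\<^sub>M N)"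
    and ae: "AE w in M. AE \<omega> in M. P w (g \<omega>)"
  shows "AE \<omega> in M. P \<omega> (g \<omega>)"
proof -
  have space_F: "space F = space M" and sets_F: "sets F \<subseteq> sets M"
    using F by (auto simp: subalgebra_def)
  define F' where "F' = restr_to_subalg M F"
  define N' where "N' = distr M N g"
  define J where "J = distr M (F \<Otimes>\<^sub>M N) (\<lambda>\<omega>. (\<omega>, g \<omega>))"
  have id_meas [measurable]: "(\<lambda>\<omega>. \<omega>) \<in> measurable M F"
    using F by (auto simp: measurable_def subalgebra_def)
  have [measurable]: "(\<lambda>\<omega>. (\<omega>, g \<omega>)) \<in> measurable M (F \<Otimes>\<^sub>M N)" by measurable
  have sets_F': "sets F' = sets F" unfolding F'_def by (rule sets_restr_to_subalg[OF F])
  interpret N': prob_space N' unfolding N'_def by (rule prob_space_distr) simp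
  interpret F': prob_space F' unfolding F'_def by (rule prob_space_restr_to_subalg[OF F prob_space_axioms])
  have law: "F' \<Otimes>\<^sub>M N' = J"
  proof (rule pair_measure_eqI)
    show "sigma_finite_measure F'" "sigma_finite_measure N'" by unfold_locales
    show "sets (F' \<Otimes>\<^sub>M N') = sets J"
      unfolding J_def by (simp add: N'_def sets_F' cong: sets_pair_measure_cong)
    fix A B assume A: "A \<in> sets F'" and B: "B \<in> sets N'"
    have "A \<subseteq> space M" using A sets.sets_into_space sets_F' space_F by blast
    then have vim: "(\<lambda>\<omega>. (\<omega>, g \<omega>)) -` (A \<times> B) \<inter> space M = A \<inter> (g -` B \<inter> space M)" by auto
    have "emeasure F' A = emeasure M A"
      unfolding F'_def using A by (intro emeasure_restr_to_subalg[OF F]) (simp add: sets_F')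
    moreover have "emeasure N' B = emeasure M (g -` B \<inter> space M)"
      unfolding N'_def using B by (intro emeasure_distr) (auto simp: N'_def)
    moreover have "emeasure J (A \<times> B) = emeasure M (A \<inter> (g -` B \<inter> space M))"
      unfolding J_def using A B vim by (subst emeasure_distr) (auto simp: sets_F' N'_def)
    ultimately show "emeasure F' A * emeasure N' B = emeasure J (A \<times> B)"
      using ind[of A B] A B
      by (simp add: emeasure_eq_measure sets_F' N'_def flip: ennreal_mult)
  qed
  define Q where "Q = {p\<in>space (F \<Otimes>\<^sub>M N). \<not> P (fst p) (snd p)}"
  have Q: "Q \<in> sets (F \<Otimes>\<^sub>M N)" unfolding Q_def by (rule sets.sets_Collect_neg[OF meas])
  have Q': "Q \<in> sets (F' \<Otimes>\<^sub>M N')" and Q'': "Q \<in> sets (F \<Otimes>\<^sub>M N')"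
    using Q by (simp_all add: sets_F' N'_def cong: sets_pair_measure_cong)
  have "emeasure M {\<omega>\<in>space M. \<not> P \<omega> (g \<omega>)} = emeasure J Q"
    unfolding J_def using Q measurable_space[OF g]
    by (subst emeasure_distr) (auto simp: Q_def space_pair_measure space_F intro!: arg_cong[where f = "emeasure M"])
  also have "\<dots> = (\<integral>\<^sup>+w. emeasure N' (Pair w -` Q) \<partial>F')"
    unfolding law[symmetric] by (rule N'.emeasure_pair_measure_alt[OF Q'])
  also have "\<dots> = (\<integral>\<^sup>+w. emeasure N' (Pair w -` Q) \<partial>M)"
    unfolding F'_def by (rule nn_integral_subalgebra2[OF F N'.measurable_emeasure_Pair[OF Q'']])
  also have "\<dots> = (\<integral>\<^sup>+w. 0 \<partial>M)"
  proof (rule nn_integral_cong_AE)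
    show "AE w in M. emeasure N' (Pair w -` Q) = 0"
      using ae
    proof (rule AE_mp, intro AE_I2 impI)
      fix w assume w: "w \<in> space M" and P: "AE \<omega> in M. P w (g \<omega>)"
      have sec: "Pair w -` Q \<in> sets N" by (rule sets_Pair1[OF Q])
      have "emeasure N' (Pair w -` Q) = emeasure M (g -` (Pair w -` Q) \<inter> space M)"
        unfolding N'_def by (rule emeasure_distr[OF g sec])
      also have "\<dots> = 0"
      proof -
        have "AE \<omega> in M. \<omega> \<notin> g -` (Pair w -` Q) \<inter> space M"
          using P by (rule AE_mp) (auto simp: Q_def)
        then show ?thesis
          using AE_iff_measurable[OF measurable_sets[OF g sec], of "\<lambda>\<omega>. \<omega> \<notin> g -` (Pair w -` Q) \<inter> space M"]
          by auto
      qed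
      finally show "emeasure N' (Pair w -` Q) = 0" .
    qed
  qed
  finally have zero: "emeasure M {\<omega>\<in>space M. \<not> P \<omega> (g \<omega>)} = 0" by simp
  have "(\<lambda>\<omega>. (\<omega>, g \<omega>)) -` Q \<inter> space M \<in> sets M" by (rule measurable_sets[OF _ Q]) measurable
  also have "(\<lambda>\<omega>. (\<omega>, g \<omega>)) -` Q \<inter> space M = {\<omega>\<in>space M. \<not> P \<omega> (g \<omega>)}"
    using measurable_space[OF g] by (auto simp: Q_def space_pair_measure space_F)
  finally show ?thesis by (rule AE_I[OF order_refl zero])
qed

text \<open>The coefficients may be treated as deterministic: an almost sure statement about the random fields
and the sequence \<open>g\<close> follows from the same statement with the fields evaluated at a fixed sample
point. Measurability is required for every sigma-algebra that makes the fields measurable, because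
the one generated by them is used in the proof.\<close>
lemma (in prob_space) AE_indep_sequences:
  assumes ind: "indep_sequences M K g W"
    and g [measurable]: "\<And>n. g n \<in> borel_measurable M"
    and W: "\<And>n x. x \<in> K \<Longrightarrow> W n x \<in> borel_measurable M"
    and meas: "\<And>F. (\<And>n x. x \<in> K \<Longrightarrow> W n x \<in> borel_measurable F) \<Longrightarrow> space F = space M \<Longrightarrow>
      {p\<in>space (F \<Otimes>\<^sub>M PiM UNIV (\<lambda>_. borel)). P (\<lambda>n x. W n x (fst p)) (snd p)}
        \<in> sets (F \<Otimes>\<^sub>M PiM UNIV (\<lambda>_. borel))"
    and ae: "AE w in M. AE \<omega> in M. P (\<lambda>n x. W n x w) (\<lambda>n. g n \<omega>)"
  shows "AE \<omega> in M. P (\<lambda>n x. W n x \<omega>) (\<lambda>n. g n \<omega>)"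
proof -
  let ?GW = "{W n x -` A \<inter> space M |n x A. x \<in> K \<and> A \<in> sets borel}"
  let ?Gg = "{g n -` A \<inter> space M |n A. A \<in> sets (borel :: complex measure)}"
  define F where "F = sigma (space M) ?GW"
  have sets_F: "sets F = sigma_sets (space M) ?GW"
    unfolding F_def by (rule sets_measure_of) blast
  have space_F: "space F = space M"
    unfolding F_def by (rule space_measure_of_conv)
  define G where "G = sigma (space M) ?Gg"
  have sets_G: "sets G = sigma_sets (space M) ?Gg"
    unfolding G_def by (rule sets_measure_of) blast
  have space_G: "space G = space M"
    unfolding G_def by (rule space_measure_of_conv)
  have sub: "subalgebra M F"
    unfolding subalgebra_def space_F sets_F
    using W by (auto intro!: sets.sigma_sets_subset measurable_sets)
  have W_F: "W n x \<in> borel_measurable F" if "x \<in> K" for n x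
    by (rule measurableI) (use that in \<open>auto simp: space_F sets_F intro!: sigma_sets.Basic\<close>)
  have "(\<lambda>\<omega> n. g n \<omega>) \<in> measurable G (PiM UNIV (\<lambda>_. borel))"
  proof (rule measurable_PiM_single')
    show "(\<lambda>\<omega>. g i \<omega>) \<in> borel_measurable G" for i
      by (rule measurableI) (auto simp: space_G sets_G intro!: sigma_sets.Basic)
  qed auto
  then have g_G: "(\<lambda>\<omega> n. g n \<omega>) -` B \<inter> space M \<in> sigma_sets (space M) ?Gg"
    if "B \<in> sets (PiM UNIV (\<lambda>_. borel))" for B
    using measurable_sets[OF _ that, of "\<lambda>\<omega> n. g n \<omega>" G] by (simp add: space_G sets_G)
  show ?thesis
  proof (rule AE_independent_substitution[where P = "\<lambda>w. P (\<lambda>n x. W n x w)", OF sub _ _ _ ae])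
    show "(\<lambda>\<omega> n. g n \<omega>) \<in> measurable M (PiM UNIV (\<lambda>_. borel))"
      by (rule measurable_PiM_single') auto
    show "prob (A \<inter> ((\<lambda>\<omega> n. g n \<omega>) -` B \<inter> space M)) = prob A * prob ((\<lambda>\<omega> n. g n \<omega>) -` B \<inter> space M)"
      if "A \<in> sets F" "B \<in> sets (PiM UNIV (\<lambda>_. borel))" for A B
      using indep_setD[OF ind[unfolded indep_sequences_def] g_G[OF that(2)]] that(1)
      by (simp add: sets_F Int_commute mult.commute)
    show "{p \<in> space (F \<Otimes>\<^sub>M PiM UNIV (\<lambda>_. borel)). P (\<lambda>n x. W n x (fst p)) (snd p)}
      \<in> sets (F \<Otimes>\<^sub>M PiM UNIV (\<lambda>_. borel))"
      by (rule meas[OF W_F space_F])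
  qed
qed

section \<open>Finite nets of exponential size\<close>

text \<open>The grid of mesh \<open>1 / n\<close> cuts \<open>K\<close> into at most \<open>(2 * R * n + 1) ^ CARD('d)\<close> cells, labelled by the
integer parts of the coordinates of \<open>n * x\<close>. The grid points themselves may lie outside \<open>K\<close>, so one
point of \<open>K\<close> is chosen in each nonempty cell.\<close>
lemma finite_grid_net:
  fixes K :: "(real ^ 'd) set"
  assumes R: "\<And>x. x \<in> K \<Longrightarrow> norm x \<le> real R" and n: "0 < n"
  obtains D where "finite D" "D \<subseteq> K" "card D \<le> (2 * (R * n + 1)) ^ CARD('d)"
    "\<And>x. x \<in> K \<Longrightarrow> \<exists>y\<in>D. dist x y \<le> real CARD('d) / real n"
proof -
  define q :: "real ^ 'd \<Rightarrow> 'd \<Rightarrow> int" where "q x i = \<lfloor>real n * x $ i\<rfloor>" for x i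
  define T where "T = {- int (R * n) .. int (R * n)}"
  have q_T: "q x \<in> UNIV \<rightarrow>\<^sub>E T" if "x \<in> K" for x
  proof -
    have "q x i \<in> T" for i
    proof -
      have "\<bar>x $ i\<bar> \<le> real R" using component_le_norm_cart[of x i] R[OF that] by linarith
      then have "\<bar>real n * x $ i\<bar> \<le> real n * real R" by (simp add: abs_mult mult_left_mono)
      then have "- real (R * n) \<le> real n * x $ i" "real n * x $ i \<le> real (R * n)"
        by (auto simp: mult.commute abs_le_iff)
      then show ?thesis unfolding q_def T_def by (auto simp: le_floor_iff floor_le_iff)
    qed
    then show ?thesis by auto
  qed
  have fin_T: "finite (UNIV \<rightarrow>\<^sub>E T :: ('d \<Rightarrow> int) set)" by (intro finite_PiE) (auto simp: T_def)
  define D where "D = inv_into K q ` (q ` K)"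
  have qK: "q ` K \<subseteq> UNIV \<rightarrow>\<^sub>E T" using q_T by auto
  have fin: "finite (q ` K)" by (rule finite_subset[OF qK fin_T])
  have "card D \<le> card (q ` K)" unfolding D_def by (rule card_image_le[OF fin])
  also have "\<dots> \<le> card (UNIV \<rightarrow>\<^sub>E T :: ('d \<Rightarrow> int) set)" by (rule card_mono[OF fin_T qK])
  also have "\<dots> = card T ^ CARD('d)" by (rule card_funcsetE) simp
  also have "card T = nat (int (2 * (R * n) + 1))"
    unfolding T_def card_atLeastAtMost_int by (rule arg_cong[where f = nat]) simp
  also have "nat (int (2 * (R * n) + 1)) ^ CARD('d) \<le> (2 * (R * n + 1)) ^ CARD('d)"
    unfolding nat_int by (rule power_mono) simp_all
  finally have card: "card D \<le> (2 * (R * n + 1)) ^ CARD('d)" .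
  have "\<exists>y\<in>D. dist x y \<le> real CARD('d) / real n" if x: "x \<in> K" for x
  proof
    let ?y = "inv_into K q (q x)"
    show "?y \<in> D" using x by (auto simp: D_def)
    have "q ?y = q x" using x by (intro f_inv_into_f) auto
    then have fl: "\<lfloor>real n * ?y $ i\<rfloor> = \<lfloor>real n * x $ i\<rfloor>" for i by (auto simp: q_def dest: fun_cong[where x = i])
    have "\<bar>(x - ?y) $ i\<bar> \<le> 1 / real n" for i
    proof -
      have "\<bar>real n * x $ i - real n * ?y $ i\<bar> \<le> 1"
        using fl[of i] floor_correct[of "real n * x $ i"] floor_correct[of "real n * ?y $ i"]
        unfolding abs_le_iff by linarith
      then have "real n * \<bar>(x - ?y) $ i\<bar> \<le> 1"
        by (simp flip: right_diff_distrib add: abs_mult)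
      then show ?thesis using n by (simp add: field_simps)
    qed
    then have "(\<Sum>i\<in>UNIV. \<bar>(x - ?y) $ i\<bar>) \<le> (\<Sum>i\<in>(UNIV :: 'd set). 1 / real n)"
      by (intro sum_mono)
    then show "dist x ?y \<le> real CARD('d) / real n"
      using norm_le_l1_cart[of "x - ?y"] unfolding dist_norm by simp
  qed
  moreover have "D \<subseteq> K" unfolding D_def by (auto intro: inv_into_into)
  moreover have "finite D" unfolding D_def using fin by simp
  ultimately show ?thesis using card by (intro that[of D])
qed

text \<open>A power bound turns a Euclidean mesh of size \<open>2 powr (- m * k)\<close> with \<open>m * H \<ge> 1\<close> into a net at scale
\<open>2 powr (- k)\<close> for \<open>\<rho>\<close>. The nets stay of exponential size in \<open>k\<close>. Closeness in the ambient distance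
is kept as well, since the chains below have to converge and to stay inside a ball.\<close>
lemma exponential_nets:
  fixes K :: "(real ^ 'd) set" and \<rho> :: "real ^ 'd \<Rightarrow> real ^ 'd \<Rightarrow> real"
  assumes K: "bounded K" and H: "0 < H" and c2: "0 < c2"
    and \<rho>_le: "\<And>x y. norm (x - y) \<le> 1 \<Longrightarrow> \<rho> x y \<le> c2 * norm (x - y) powr H"
  obtains D B c where "\<And>k. finite (D k)" "\<And>k. D k \<subseteq> K"
    "\<And>k. real (card (D k)) \<le> B ^ Suc k" "1 \<le> B" "0 < c"
    "\<And>k x. x \<in> K \<Longrightarrow> \<exists>y\<in>D k. \<rho> x y \<le> c / 2 ^ k \<and> dist x y \<le> c / 2 ^ k"
proof -
  obtain r where r: "\<And>x. x \<in> K \<Longrightarrow> norm x \<le> r" using K unfolding bounded_iff by blast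
  define R where "R = nat \<lceil>r\<rceil>"
  have R: "norm x \<le> real R" if "x \<in> K" for x using r[OF that] unfolding R_def by linarith
  define d where "d = CARD('d)"
  have d: "0 < d" by (simp add: d_def)
  define m where "m = max 1 (nat \<lceil>1 / H\<rceil>)"
  have m: "1 \<le> m" by (simp add: m_def)
  have mH: "1 \<le> real m * H"
  proof -
    have "1 / H \<le> real m" unfolding m_def by linarith
    then show ?thesis using H by (simp add: field_simps)
  qed
  define n where "n k = d * 2 ^ (m * k)" for k
  have n: "0 < n k" for k using d by (simp add: n_def)
  have "\<forall>k. \<exists>D. finite D \<and> D \<subseteq> K \<and> card D \<le> (2 * (R * n k + 1)) ^ d \<and>
    (\<forall>x\<in>K. \<exists>y\<in>D. dist x y \<le> real d / real (n k))"
    unfolding d_def using finite_grid_net[OF R n] by (metis (no_types, lifting))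
  then obtain D where D: "\<And>k. finite (D k)" "\<And>k. D k \<subseteq> K" "\<And>k. card (D k) \<le> (2 * (R * n k + 1)) ^ d"
    "\<And>k x. x \<in> K \<Longrightarrow> \<exists>y\<in>D k. dist x y \<le> real d / real (n k)" by metis
  define B where "B = (2 * (real R * real d + 1) * 2 ^ m) ^ d"
  define c where "c = 1 + c2"
  have card: "real (card (D k)) \<le> B ^ Suc k" for k
  proof -
    let ?b = "2 * (real R * real d + 1)"
    have b: "1 \<le> ?b" by (simp add: add_increasing)
    have "real (card (D k)) \<le> real ((2 * (R * n k + 1)) ^ d)"
      using D(3)[of k] by (simp only: of_nat_le_iff)
    also have "\<dots> = (2 * (real R * (real d * 2 ^ (m * k)) + 1)) ^ d"
      by (simp add: n_def add.commute)
    also have "\<dots> \<le> (?b ^ Suc k * (2 ^ m) ^ Suc k) ^ d"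
    proof (rule power_mono)
      have "2 * (real R * (real d * 2 ^ (m * k)) + 1) \<le> ?b * 2 ^ (m * k)"
        by (simp add: algebra_simps)
      also have "\<dots> \<le> ?b ^ Suc k * (2 ^ m) ^ Suc k"
      proof (rule mult_mono)
        show "?b \<le> ?b ^ Suc k" by (rule self_le_power[OF b]) simp
        show "2 ^ (m * k) \<le> (2 ^ m :: real) ^ Suc k"
          unfolding power_mult[symmetric] by (rule power_increasing) auto
      qed (use b in auto)
      finally show "2 * (real R * (real d * 2 ^ (m * k)) + 1) \<le> ?b ^ Suc k * (2 ^ m) ^ Suc k" .
    qed simp
    also have "\<dots> = ((?b * 2 ^ m) ^ Suc k) ^ d" by (simp only: power_mult_distrib)
    also have "\<dots> = ((?b * 2 ^ m) ^ d) ^ Suc k" by (metis power_mult mult.commute)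
    also have "\<dots> = B ^ Suc k" by (simp only: B_def)
    finally show ?thesis .
  qed
  have "1 \<le> B"
  proof -
    have "1 * 1 \<le> 2 * (real R * real d + 1) * 2 ^ m" by (intro mult_mono) (auto simp: add_increasing)
    then show ?thesis unfolding B_def by (intro one_le_power) simp
  qed
  have net: "\<exists>y\<in>D k. \<rho> x y \<le> c / 2 ^ k \<and> dist x y \<le> c / 2 ^ k" if x: "x \<in> K" for k x
  proof -
    obtain y where y: "y \<in> D k" "dist x y \<le> real d / real (n k)" using D(4)[OF x] by blast
    have "real d / real (n k) = 1 / 2 ^ (m * k)" using d by (simp add: n_def)
    then have dxy: "dist x y \<le> 1 / 2 ^ (m * k)" using y(2) by simp
    also have "\<dots> \<le> 1 / 2 ^ k" using m by (intro divide_left_mono power_increasing) auto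
    finally have dxy': "dist x y \<le> 1 / 2 ^ k" .
    have "(1::real) / 2 ^ (m * k) \<le> 1" by simp
    then have "norm (x - y) \<le> 1" using dxy unfolding dist_norm by linarith
    then have "\<rho> x y \<le> c2 * dist x y powr H" unfolding dist_norm by (rule \<rho>_le)
    also have "\<dots> \<le> c2 * (1 / 2 ^ (m * k)) powr H"
      using dxy H c2 by (intro mult_left_mono powr_mono2) auto
    also have "(1 / 2 ^ (m * k)) powr H = 2 powr (- (real m * H * k))"
      by (simp add: powr_divide powr_minus_divide powr_powr mult_ac flip: powr_realpow)
    also have "2 powr (- (real m * H * k)) \<le> 2 powr (- real k)"
      using mult_right_mono[OF mH, of "real k"] by (intro powr_mono) auto
    also have "2 powr (- real k) = 1 / 2 ^ k" by (simp add: powr_minus_divide powr_realpow)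
    finally have "\<rho> x y \<le> c2 / 2 ^ k" using c2 by (simp add: mult_left_mono)
    then have "\<rho> x y \<le> c / 2 ^ k" using c2 by (simp add: c_def add_divide_distrib add_increasing)
    moreover have "dist x y \<le> c / 2 ^ k" using dxy' c2 by (simp add: c_def add_divide_distrib add_increasing2)
    ultimately show ?thesis using y(1) by blast
  qed
  show ?thesis by (rule that[OF D(1,2) card \<open>1 \<le> B\<close> _ net]) (use c2 in \<open>auto simp: c_def\<close>)
qed

section \<open>Powers with a logarithmic factor along dyadic scales\<close>

text \<open>Powers of comparable quantities are comparable whatever the sign of the exponent, which is why the
constant involves \<open>\<bar>\<eta>\<bar>\<close>.\<close>
lemma powr_le_of_comparable:
  fixes p q B \<eta> :: real
  assumes "0 < p" "0 < q" "p \<le> B * q" "q \<le> B * p" "1 \<le> B"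
  shows "p powr \<eta> \<le> B powr \<bar>\<eta>\<bar> * q powr \<eta>"
proof (cases "0 \<le> \<eta>")
  case True
  then have "p powr \<eta> \<le> (B * q) powr \<eta>" using assms by (intro powr_mono2) auto
  then show ?thesis using assms True by (simp add: powr_mult)
next
  case False
  then have "p powr \<eta> \<le> (q / B) powr \<eta>"
    using assms by (intro powr_mono2') (auto simp: field_simps)
  also have "\<dots> = B powr \<bar>\<eta>\<bar> * q powr \<eta>"
    using assms False by (simp add: powr_divide powr_minus field_simps)
  finally show ?thesis .
qed

text \<open>A decaying exponential absorbs the effect of a shift on a power, uniformly in the base point as long
as the latter stays away from \<open>0\<close>. Later estimates then need neither a case distinction on the
sign of \<open>\<eta>\<close> nor the monotonicity of \<open>h powr \<beta> * \<bar>ln h\<bar> powr \<eta>\<close> near \<open>h = 0\<close>.\<close>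
lemma exp_absorbs_powr_shift:
  fixes b \<eta> :: real
  assumes b: "0 < b"
  obtains C where "0 < C"
    "\<And>l u. 1 / 2 \<le> l \<Longrightarrow> 0 \<le> u \<Longrightarrow> exp (- (b * u)) * (l + u) powr \<eta> \<le> C * l powr \<eta>"
proof (cases "\<eta> \<le> 0")
  case True
  have "exp (- (b * u)) * (l + u) powr \<eta> \<le> 1 * l powr \<eta>" if "1 / 2 \<le> l" "0 \<le> u" for l u
    using that True b by (intro mult_mono powr_mono2') auto
  then show ?thesis by (rule that[OF zero_less_one])
next
  case False
  define a where "a = b / \<eta>"
  have a: "0 < a" "a * \<eta> = b" using False b by (auto simp: a_def)
  define c where "c = max 1 (2 / a)"
  have c: "1 \<le> c" "2 \<le> c * a" using a by (auto simp: c_def max_def field_simps)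
  have "exp (- (b * u)) * (l + u) powr \<eta> \<le> c powr \<eta> * l powr \<eta>" if "1 / 2 \<le> l" "0 \<le> u" for l u
  proof -
    have "l + u \<le> l * (1 + 2 * u)" using that mult_right_mono[of 1 "2 * l" u] by (simp add: algebra_simps)
    also have "1 + 2 * u \<le> c * (1 + a * u)"
      using c that mult_right_mono[of 2 "c * a" u] by (simp add: algebra_simps)
    also have "1 + a * u \<le> exp (a * u)" by (rule exp_ge_add_one_self)
    finally have "l + u \<le> l * (c * exp (a * u))"
      using that c by (simp add: mult_left_mono)
    then have "(l + u) powr \<eta> \<le> (l * (c * exp (a * u))) powr \<eta>"
      using that False by (intro powr_mono2) auto
    also have "\<dots> = l powr \<eta> * (c powr \<eta> * exp (b * u))"
      using that c a by (simp add: powr_mult powr_def[of "exp _"] mult.commute mult.left_commute)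
    finally have "exp (- (b * u)) * (l + u) powr \<eta>
        \<le> exp (- (b * u)) * (l powr \<eta> * (c powr \<eta> * exp (b * u)))"
      by (intro mult_left_mono) auto
    also have "\<dots> = c powr \<eta> * l powr \<eta>" by (simp add: exp_minus field_simps)
    finally show ?thesis .
  qed
  moreover have "0 < c powr \<eta>" using c by simp
  ultimately show ?thesis by (rule that[rotated])
qed

text \<open>For \<open>b = \<beta> * ln 2\<close> this is, up to constants, the value of \<open>h powr \<beta> * \<bar>ln h\<bar> powr \<eta>\<close> at
\<open>h = 1 / 2 ^ k\<close>, if \<open>k \<ge> 1\<close>. The shift \<open>k + 1\<close> keeps the base of the power positive at \<open>k = 0\<close>.\<close>
definition dyadic_gauge :: "real \<Rightarrow> real \<Rightarrow> nat \<Rightarrow> real" where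
  "dyadic_gauge b \<eta> k = exp (- (b * k)) * (k + 1) powr \<eta>"

lemma dyadic_gauge_nonneg [simp]: "0 \<le> dyadic_gauge b \<eta> k"
  by (simp add: dyadic_gauge_def)

text \<open>The square root of the level raises the exponent of the logarithm by \<open>1 / 2\<close>.\<close>
lemma sqrt_mult_dyadic_gauge: "sqrt (real k + 1) * dyadic_gauge b \<eta> k = dyadic_gauge b (\<eta> + 1 / 2) k"
  by (simp add: dyadic_gauge_def powr_add powr_half_sqrt)

lemma dyadic_gauge_geometric_decay:
  assumes "0 < b"
  obtains C where "0 < C"
    "\<And>i j. dyadic_gauge b \<eta> (j + i) \<le> C * exp (- (b / 2)) ^ i * dyadic_gauge b \<eta> j"
proof -
  obtain C where C: "0 < C"
    "\<And>l u. 1 / 2 \<le> l \<Longrightarrow> 0 \<le> u \<Longrightarrow> exp (- (b / 2 * u)) * (l + u) powr \<eta> \<le> C * l powr \<eta>"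
    using exp_absorbs_powr_shift[of "b / 2" \<eta>] assms by auto
  have "dyadic_gauge b \<eta> (j + i) \<le> C * exp (- (b / 2)) ^ i * dyadic_gauge b \<eta> j" for i j
  proof -
    have "dyadic_gauge b \<eta> (j + i)
        = exp (- (b * j)) * exp (- (b / 2)) ^ i * (exp (- (b / 2 * i)) * (real j + 1 + i) powr \<eta>)"
    proof -
      have "exp (- (b / 2)) ^ i = exp (- (b / 2 * i))"
        by (simp add: mult.commute flip: exp_of_nat_mult)
      moreover have "exp (- (b * real (j + i))) = exp (- (b * j)) * exp (- (b / 2 * i)) * exp (- (b / 2 * i))"
        unfolding exp_add[symmetric] by (simp add: algebra_simps)
      ultimately show ?thesis by (simp add: dyadic_gauge_def add_ac mult.assoc)
    qed
    also have "\<dots> \<le> exp (- (b * j)) * exp (- (b / 2)) ^ i * (C * (real j + 1) powr \<eta>)"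
      by (intro mult_left_mono C(2)) auto
    also have "\<dots> = C * exp (- (b / 2)) ^ i * dyadic_gauge b \<eta> j"
      by (simp add: dyadic_gauge_def add_ac)
    finally show ?thesis .
  qed
  with C(1) show ?thesis by (rule that)
qed

text \<open>The gauges decay geometrically, so the sum over all levels from \<open>j\<close> on costs only a constant
compared with level \<open>j\<close>: summing along a chain does not worsen the modulus of continuity.\<close>
lemma sum_dyadic_gauge_le:
  assumes "0 < b"
  obtains C where "0 < C" "\<And>j m. (\<Sum>k\<in>{j..<m}. dyadic_gauge b \<eta> k) \<le> C * dyadic_gauge b \<eta> j"
proof -
  obtain C where C: "0 < C"
    "\<And>i j. dyadic_gauge b \<eta> (j + i) \<le> C * exp (- (b / 2)) ^ i * dyadic_gauge b \<eta> j"
    using dyadic_gauge_geometric_decay[OF assms] by blast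
  define q where "q = exp (- (b / 2))"
  have q: "0 < q" "q < 1" using assms by (auto simp: q_def)
  have "(\<Sum>k\<in>{j..<m}. dyadic_gauge b \<eta> k) \<le> (C / (1 - q)) * dyadic_gauge b \<eta> j" for j m
  proof -
    have "(\<Sum>k\<in>{j..<m}. dyadic_gauge b \<eta> k) = (\<Sum>i<m - j. dyadic_gauge b \<eta> (j + i))"
      by (rule sum.reindex_bij_witness[of _ "\<lambda>i. j + i" "\<lambda>k. k - j"]) auto
    also have "\<dots> \<le> (\<Sum>i<m - j. C * q ^ i * dyadic_gauge b \<eta> j)"
      unfolding q_def by (intro sum_mono C(2))
    also have "\<dots> = C * dyadic_gauge b \<eta> j * (\<Sum>i<m - j. q ^ i)"
      by (simp add: sum_distrib_left mult_ac)
    also have "(\<Sum>i<m - j. q ^ i) \<le> 1 / (1 - q)"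
      using q by (simp add: sum_gp_strict divide_right_mono)
    finally show ?thesis using C(1) by (simp add: mult_left_mono)
  qed
  moreover have "0 < C / (1 - q)" using C q by simp
  ultimately show ?thesis by (rule that[rotated])
qed

lemma dyadic_gauge_tendsto_0:
  assumes "0 < b"
  shows "dyadic_gauge b \<eta> \<longlonglongrightarrow> 0"
proof -
  obtain C where C: "0 < C"
    "\<And>i j. dyadic_gauge b \<eta> (j + i) \<le> C * exp (- (b / 2)) ^ i * dyadic_gauge b \<eta> j"
    using dyadic_gauge_geometric_decay[OF assms] by blast
  have "(\<lambda>i. C * exp (- (b / 2)) ^ i * dyadic_gauge b \<eta> 0) \<longlonglongrightarrow> C * 0 * dyadic_gauge b \<eta> 0"
    using assms by (intro tendsto_intros LIMSEQ_power_zero) auto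
  then have lim: "(\<lambda>i. C * exp (- (b / 2)) ^ i * dyadic_gauge b \<eta> 0) \<longlonglongrightarrow> 0" by simp
  have "norm (dyadic_gauge b \<eta> i) \<le> C * exp (- (b / 2)) ^ i * dyadic_gauge b \<eta> 0" for i
    using C(2)[of 0 i] by simp
  then show ?thesis by (intro Lim_null_comparison[OF _ lim] always_eventually allI)
qed

text \<open>With \<open>l = k * ln 2 - ln c\<close> one has \<open>h = exp (- (l + u))\<close> for some \<open>u \<ge> 0\<close>, and the exponential in \<open>u\<close>
absorbs the shift from \<open>l\<close> to \<open>l + u\<close> in the logarithmic factor. For large \<open>k\<close> the quantity \<open>l\<close> is
comparable to \<open>k + 1\<close>.\<close>
lemma pow_log_le_dyadic_gauge:
  fixes \<beta> \<eta> c :: real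
  assumes "0 < \<beta>" "0 < c"
  obtains C J where "0 < C"
    "\<And>k h. J \<le> k \<Longrightarrow> 0 < h \<Longrightarrow> h \<le> c / 2 ^ k \<Longrightarrow>
       h < 1 \<and> h powr \<beta> * \<bar>ln h\<bar> powr \<eta> \<le> C * dyadic_gauge (\<beta> * ln 2) \<eta> k"
proof -
  obtain C where C: "0 < C"
    "\<And>l u. 1 / 2 \<le> l \<Longrightarrow> 0 \<le> u \<Longrightarrow> exp (- (\<beta> * u)) * (l + u) powr \<eta> \<le> C * l powr \<eta>"
    using exp_absorbs_powr_shift[OF assms(1)] by blast
  define B where "B = 2 + \<bar>ln c\<bar>"
  \<comment> \<open>Large enough for \<open>(k + 1) / 2 \<le> 2 / 3 * k - \<bar>ln c\<bar>\<close> to hold for \<open>k \<ge> J\<close>, where \<open>2 / 3 \<le> ln 2\<close>.\<close>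
  define J where "J = nat \<lceil>3 + 6 * \<bar>ln c\<bar>\<rceil>"
  have "h < 1 \<and> h powr \<beta> * \<bar>ln h\<bar> powr \<eta>
      \<le> (C * c powr \<beta> * B powr \<bar>\<eta>\<bar>) * dyadic_gauge (\<beta> * ln 2) \<eta> k"
    if k: "J \<le> k" and h: "0 < h" "h \<le> c / 2 ^ k" for k h
  proof -
    define l where "l = k * ln 2 - ln c"
    define u where "u = - ln h - l"
    have k': "3 + 6 * \<bar>ln c\<bar> \<le> k" using k unfolding J_def by linarith
    have "2 / 3 * real k \<le> ln 2 * k" using ln2_ge_two_thirds by (intro mult_right_mono) auto
    moreover have "ln 2 * real k \<le> 1 * real k" using ln_2_less_1 by (intro mult_right_mono) auto
    ultimately have l1: "(real k + 1) / 2 \<le> l" and l2: "l \<le> k + \<bar>ln c\<bar>"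
      using k' unfolding l_def by (simp_all add: mult.commute)
    have "1 / 2 \<le> (real k + 1) / 2" by simp
    then have l3: "1 / 2 \<le> l" using l1 by (rule order_trans)
    have "ln h \<le> ln (c / 2 ^ k)" using h by (intro ln_mono) auto
    also have "\<dots> = - l" using assms by (simp add: l_def ln_div ln_realpow)
    finally have u: "0 \<le> u" by (simp add: u_def)
    have lnh: "\<bar>ln h\<bar> = l + u" using u l3 by (simp add: u_def)
    have "ln h < 0" using u l3 by (simp add: u_def)
    then have "h < 1" using h by simp
    have "h powr \<beta> * \<bar>ln h\<bar> powr \<eta> = exp (- (\<beta> * l)) * (exp (- (\<beta> * u)) * (l + u) powr \<eta>)"
      unfolding lnh using h by (simp add: powr_def u_def algebra_simps flip: exp_add)
    also have "\<dots> \<le> exp (- (\<beta> * l)) * (C * l powr \<eta>)"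
      by (intro mult_left_mono C(2) l3 u) simp
    also have "\<dots> \<le> exp (- (\<beta> * l)) * (C * (B powr \<bar>\<eta>\<bar> * (real k + 1) powr \<eta>))"
    proof (intro mult_left_mono powr_le_of_comparable)
      show "l \<le> B * (real k + 1)"
      proof -
        note l2
        also have "k + \<bar>ln c\<bar> \<le> 2 * (real k + 1) + \<bar>ln c\<bar> * (real k + 1)"
          by (simp add: algebra_simps)
        also have "\<dots> = B * (real k + 1)" by (simp add: B_def algebra_simps)
        finally show ?thesis .
      qed
      have "1 * real k + 1 \<le> 2 * l" using l1 by simp
      also have "\<dots> \<le> B * l" using l3 by (intro mult_right_mono) (auto simp: B_def)
      finally show "real k + 1 \<le> B * l" by simp
    qed (use l3 C(1) in \<open>auto simp: B_def\<close>)
    also have "exp (- (\<beta> * l)) = c powr \<beta> * exp (- (\<beta> * ln 2 * k))"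
      using assms by (simp add: powr_def l_def algebra_simps flip: exp_add)
    finally show ?thesis using \<open>h < 1\<close> by (simp add: dyadic_gauge_def add_ac mult_ac)
  qed
  moreover have "0 < C * c powr \<beta> * B powr \<bar>\<eta>\<bar>" using C assms by (auto simp: B_def)
  ultimately show ?thesis by (rule that[rotated])
qed

text \<open>For \<open>h\<close> between consecutive dyadic scales \<open>\<bar>ln h\<bar>\<close> lies between \<open>j * ln 2\<close> and \<open>(j + 1) * ln 2\<close>; it is
comparable to \<open>j + 1\<close> only for \<open>j \<ge> 1\<close>, since for \<open>j = 0\<close> it may vanish.\<close>
lemma dyadic_gauge_le_pow_log:
  fixes \<beta> \<eta> :: real
  assumes "0 < \<beta>"
  obtains C where "0 < C"
    "\<And>j h. 1 \<le> j \<Longrightarrow> 1 / 2 ^ Suc j < h \<Longrightarrow> h \<le> 1 / 2 ^ j \<Longrightarrow>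
       dyadic_gauge (\<beta> * ln 2) \<eta> j \<le> C * (h powr \<beta> * \<bar>ln h\<bar> powr \<eta>)"
proof -
  have "dyadic_gauge (\<beta> * ln 2) \<eta> j \<le> (2 powr \<beta> * 3 powr \<bar>\<eta>\<bar>) * (h powr \<beta> * \<bar>ln h\<bar> powr \<eta>)"
    if j: "1 \<le> j" and h: "1 / 2 ^ Suc j < h" "h \<le> 1 / 2 ^ j" for j :: nat and h
  proof -
    have "0 < h" using h(1) by (rule less_trans[rotated]) simp
    have "ln (1 / 2 ^ Suc j) < ln h" using h(1) \<open>0 < h\<close> by (subst ln_less_cancel_iff) auto
    then have 1: "- ln h < (real j + 1) * ln 2" by (simp add: ln_div ln_realpow ln_mult algebra_simps)
    have "ln h \<le> ln (1 / 2 ^ j)" using h(2) \<open>0 < h\<close> by (intro ln_mono) auto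
    then have 2: "j * ln 2 \<le> - ln h" by (simp add: ln_div ln_realpow)
    have "2 / 3 * real j \<le> ln 2 * j" using ln2_ge_two_thirds by (intro mult_right_mono) auto
    moreover have "ln 2 * (real j + 1) \<le> 1 * (real j + 1)"
      using ln_2_less_1 by (intro mult_right_mono) auto
    ultimately have 3: "2 / 3 * real j \<le> - ln h" "- ln h \<le> real j + 1"
      using 1 2 by (simp_all only: mult.commute[of "ln 2"] mult_1)
    have "(real j + 1) powr \<eta> \<le> 3 powr \<bar>\<eta>\<bar> * \<bar>ln h\<bar> powr \<eta>"
      using 3 j by (intro powr_le_of_comparable) auto
    moreover have "exp (- (\<beta> * ln 2 * j)) \<le> 2 powr \<beta> * h powr \<beta>"
    proof -
      have "- (\<beta> * ln 2 * j) \<le> \<beta> * ln 2 + \<beta> * ln h"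
        using mult_left_mono[of "- ln h" "(real j + 1) * ln 2" \<beta>] 1 assms by (simp add: algebra_simps)
      then show ?thesis using \<open>0 < h\<close> by (simp add: powr_def flip: exp_add)
    qed
    ultimately have "dyadic_gauge (\<beta> * ln 2) \<eta> j \<le> (2 powr \<beta> * h powr \<beta>) * (3 powr \<bar>\<eta>\<bar> * \<bar>ln h\<bar> powr \<eta>)"
      unfolding dyadic_gauge_def by (intro mult_mono) (auto simp: add_ac)
    then show ?thesis by (simp add: mult_ac)
  qed
  moreover have "0 < 2 powr \<beta> * 3 powr \<bar>\<eta>\<bar>" by simp
  ultimately show ?thesis by (rule that[rotated])
qed

lemma dyadic_scale_exists:
  fixes h :: real
  assumes "0 < h" "h \<le> 1 / 2 ^ J"
  obtains j where "J \<le> j" "1 / 2 ^ Suc j < h" "h \<le> 1 / 2 ^ j"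
proof -
  obtain n where n: "(1 / 2) ^ n < h" using real_arch_pow_inv[of h "1/2"] assms by auto
  define m where "m = (LEAST n. 1 / 2 ^ n < h)"
  have m: "1 / 2 ^ m < h" unfolding m_def
    by (rule LeastI[of _ n]) (use n in \<open>simp add: power_one_over\<close>)
  have "J < m"
  proof (rule ccontr)
    assume "\<not> J < m"
    then have "(1::real) / 2 ^ J \<le> 1 / 2 ^ m" by (intro divide_left_mono power_increasing) auto
    then show False using m assms by simp
  qed
  then obtain j where j: "m = Suc j" by (cases m) auto
  have "\<not> 1 / 2 ^ j < h" using not_less_Least[of j "\<lambda>n. 1 / 2 ^ n < h"] j unfolding m_def by simp
  then have "h \<le> 1 / 2 ^ j" by (simp only: not_less)
  have "1 / 2 ^ Suc j < h" using m unfolding j .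
  have "J \<le> j" using \<open>J < m\<close> j by simp
  show ?thesis by (rule that) fact+
qed


section \<open>Chaining along the nets\<close>

text \<open>The chaining argument, on a single sample path. For \<open>\<rho> x y \<le> 1 / 2 ^ j\<close>, the points \<open>x\<close> and \<open>y\<close> are
joined by a path through the nets: from \<open>x\<close> along its net points of levels \<open>m, m - 1, \<dots>\<close> down to
level \<open>j\<close>, then across to the net point of \<open>y\<close> at level \<open>j\<close>, and up to \<open>y\<close>. By the quasi-triangle
inequality every link at level \<open>k\<close> has \<open>\<rho>\<close>-length at most a constant times \<open>1 / 2 ^ k\<close>, so the
increment over it is at most a constant times \<open>sqrt (k + 1) * dyadic_gauge (\<beta> * ln 2) \<eta> k\<close>. Letting
\<open>m\<close> tend to infinity uses the continuity of each \<open>f N\<close> only qualitatively, hence all the bounds are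
uniform in \<open>N\<close>. Half of the radius is given up to keep the net points inside the ball where \<open>s_le\<close>
holds.\<close>
lemma chaining_modulus:
  fixes f :: "nat \<Rightarrow> 'b::metric_space \<Rightarrow> complex"
  assumes qm: "quasi_metric \<rho>"
    and D: "\<And>k. D k \<subseteq> K"
    and net: "\<And>k x. x \<in> K \<Longrightarrow> \<exists>y\<in>D k. \<rho> x y \<le> c / 2 ^ k \<and> dist x y \<le> c / 2 ^ k"
    and cont: "\<And>N. continuous_on K (f N)"
    and pos: "0 < c" "0 < \<beta>" "0 < \<gamma>" "0 < A" "0 < C0"
    and s_le: "\<And>x y. x \<in> cball x0 \<gamma> \<inter> K \<Longrightarrow> y \<in> cball x0 \<gamma> \<inter> K \<Longrightarrow> 0 < \<rho> x y \<Longrightarrow> \<rho> x y < 1 \<Longrightarrow>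
      s x y \<le> C0 * (\<rho> x y powr \<beta> * \<bar>ln (\<rho> x y)\<bar> powr \<eta>)"
    and incr: "\<And>k x y N. J \<le> k \<Longrightarrow> x \<in> D k \<union> D (Suc k) \<Longrightarrow> y \<in> D k \<union> D (Suc k) \<Longrightarrow>
      cmod (f N x - f N y) \<le> A * sqrt (real k + 1) * s x y"
  obtains C J' where "0 < C"
    "\<And>j x y N. J' \<le> j \<Longrightarrow> x \<in> cball x0 (\<gamma> / 2) \<inter> K \<Longrightarrow> y \<in> cball x0 (\<gamma> / 2) \<inter> K \<Longrightarrow>
      \<rho> x y \<le> 1 / 2 ^ j \<Longrightarrow> cmod (f N x - f N y) \<le> C * dyadic_gauge (\<beta> * ln 2) (\<eta> + 1 / 2) j"
proof -
  obtain \<kappa> where \<kappa>: "1 \<le> \<kappa>" and tri: "\<And>x y z. \<rho> x z \<le> \<kappa> * (\<rho> x y + \<rho> y z)"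
    using qm by (auto simp: quasi_metric_def)
  have \<rho>_nonneg: "0 \<le> \<rho> x y" and \<rho>_eq_0: "\<rho> x y = 0 \<longleftrightarrow> x = y" and \<rho>_sym: "\<rho> x y = \<rho> y x" for x y
    using qm by (auto simp: quasi_metric_def)
  define b where "b = \<beta> * ln 2"
  have b: "0 < b" using pos by (simp add: b_def)
  \<comment> \<open>Bounds, in units of \<open>1 / 2 ^ k\<close>, the \<open>\<rho>\<close>-lengths of all the links at level \<open>k\<close>;
      the two kinds of links are dealt with in \<open>le_c3\<close>.\<close>
  define c3 where "c3 = \<kappa>\<^sup>2 * (1 + 2 * c)"
  have c3: "0 < c3" using \<kappa> pos by (simp add: c3_def add_pos_pos)
  obtain C1 J1 where C1: "0 < C1"
    and gauge: "\<And>k h. J1 \<le> k \<Longrightarrow> 0 < h \<Longrightarrow> h \<le> c3 / 2 ^ k \<Longrightarrow>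
       h < 1 \<and> h powr \<beta> * \<bar>ln h\<bar> powr \<eta> \<le> C1 * dyadic_gauge b \<eta> k"
    using pow_log_le_dyadic_gauge[OF pos(2) c3, of \<eta>] unfolding b_def by blast
  obtain C2 where C2: "0 < C2"
    "\<And>j m. (\<Sum>k\<in>{j..<m}. dyadic_gauge b (\<eta> + 1 / 2) k) \<le> C2 * dyadic_gauge b (\<eta> + 1 / 2) j"
    using sum_dyadic_gauge_le[OF b, of "\<eta> + 1 / 2"] by blast
  have "\<exists>J2. \<forall>k\<ge>J2. c / 2 ^ k < \<gamma> / 2"
  proof -
    have "(\<lambda>k. c * (1 / 2) ^ k) \<longlonglongrightarrow> c * 0" by (intro tendsto_intros LIMSEQ_power_zero) simp
    then have "eventually (\<lambda>k. c * (1 / 2) ^ k < \<gamma> / 2) sequentially"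
      using pos by (intro order_tendstoD(2)[of _ "c * 0"]) auto
    then show ?thesis by (simp add: eventually_sequentially power_one_over)
  qed
  then obtain J2 where J2: "\<And>k. J2 \<le> k \<Longrightarrow> c / 2 ^ k < \<gamma> / 2" by blast
  define p where "p k x = (SOME y. y \<in> D k \<and> \<rho> x y \<le> c / 2 ^ k \<and> dist x y \<le> c / 2 ^ k)" for k x
  have p: "p k x \<in> D k \<and> \<rho> x (p k x) \<le> c / 2 ^ k \<and> dist x (p k x) \<le> c / 2 ^ k" if "x \<in> K" for k x
    using someI_ex[of "\<lambda>y. y \<in> D k \<and> \<rho> x y \<le> c / 2 ^ k \<and> dist x y \<le> c / 2 ^ k"] net[OF that, of k]
    unfolding p_def by blast
  define J' where "J' = max J (max J1 J2)"
  define G where "G = dyadic_gauge b (\<eta> + 1 / 2)"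
  define E where "E = A * (C0 * C1)"
  have E: "0 < E" using pos C1 by (simp add: E_def)
  \<comment> \<open>The increment over a single link.\<close>
  have near: "cmod (f N u - f N v) \<le> E * G k"
    if k: "J' \<le> k" and uv: "u \<in> D k \<union> D (Suc k)" "v \<in> D k \<union> D (Suc k)"
      "u \<in> cball x0 \<gamma>" "v \<in> cball x0 \<gamma>" "\<rho> u v \<le> c3 / 2 ^ k" for k u v N
  proof (cases "u = v")
    case True
    then show ?thesis using E by (simp add: G_def)
  next
    case False
    then have 0: "0 < \<rho> u v" using \<rho>_nonneg[of u v] \<rho>_eq_0[of u v] by linarith
    have "u \<in> cball x0 \<gamma> \<inter> K" "v \<in> cball x0 \<gamma> \<inter> K" using uv D by blast+
    moreover have "J1 \<le> k" "J \<le> k" using k by (auto simp: J'_def)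
    ultimately have "s u v \<le> C0 * (C1 * dyadic_gauge b \<eta> k)"
      using s_le[of u v] gauge[of k "\<rho> u v"] 0 uv(5) pos(5)
      by (meson mult_left_mono less_imp_le order_trans)
    then have "A * sqrt (real k + 1) * s u v \<le> A * sqrt (real k + 1) * (C0 * (C1 * dyadic_gauge b \<eta> k))"
      using pos by (intro mult_left_mono) auto
    also have "\<dots> = E * (sqrt (real k + 1) * dyadic_gauge b \<eta> k)" by (simp add: E_def)
    also have "\<dots> = E * G k" by (simp only: sqrt_mult_dyadic_gauge G_def)
    finally show ?thesis using incr[OF \<open>J \<le> k\<close> uv(1,2), of N] by linarith
  qed
  have p_ball: "p k x \<in> cball x0 \<gamma>" if "x \<in> cball x0 (\<gamma> / 2) \<inter> K" "J' \<le> k" for k x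
  proof -
    have "J2 \<le> k" using that(2) by (simp add: J'_def)
    moreover have "dist x (p k x) \<le> c / 2 ^ k" using p[of x k] that(1) by blast
    ultimately have "dist x (p k x) \<le> \<gamma> / 2" using J2[of k] by linarith
    moreover have "dist x0 (p k x) \<le> dist x0 x + dist x (p k x)" by (rule dist_triangle)
    moreover have "dist x0 x \<le> \<gamma> / 2" using that by simp
    ultimately show ?thesis by simp
  qed
  have le_c3: "\<kappa> * c + \<kappa>\<^sup>2 * (1 + c) \<le> c3" "2 * (\<kappa> * c) \<le> c3"
  proof -
    have "\<kappa> * c \<le> \<kappa>\<^sup>2 * c" using \<kappa> pos by (intro mult_right_mono self_le_power) auto
    moreover have "0 \<le> \<kappa>\<^sup>2" "0 \<le> \<kappa>\<^sup>2 * c" using pos by simp_all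
    moreover have "c3 = \<kappa>\<^sup>2 + 2 * (\<kappa>\<^sup>2 * c)" "\<kappa>\<^sup>2 * (1 + c) = \<kappa>\<^sup>2 + \<kappa>\<^sup>2 * c"
      by (simp_all add: c3_def algebra_simps)
    ultimately show "\<kappa> * c + \<kappa>\<^sup>2 * (1 + c) \<le> c3" "2 * (\<kappa> * c) \<le> c3"
      by linarith+
  qed
  \<comment> \<open>The part of the chain from a point to its net point at level \<open>j\<close>.\<close>
  have link: "cmod (f N (p j x) - f N x) \<le> E * C2 * G j"
    if x: "x \<in> cball x0 (\<gamma> / 2) \<inter> K" and j: "J' \<le> j" for j x N
  proof -
    have tele: "cmod (f N (p j x) - f N (p m x)) \<le> E * (\<Sum>k\<in>{j..<m}. G k)" if "j \<le> m" for m
      using that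
    proof (induction m rule: dec_induct)
      case (step m)
      have "\<rho> (p m x) (p (Suc m) x) \<le> \<kappa> * (\<rho> (p m x) x + \<rho> x (p (Suc m) x))" by (rule tri)
      also have "\<dots> \<le> \<kappa> * (c / 2 ^ m + c / 2 ^ m)"
      proof (intro mult_left_mono add_mono)
        show "\<rho> (p m x) x \<le> c / 2 ^ m" using p[of x m] x \<rho>_sym by simp
        have "c / 2 ^ Suc m \<le> c / 2 ^ m" using pos by (intro divide_left_mono) auto
        then show "\<rho> x (p (Suc m) x) \<le> c / 2 ^ m" using p[of x "Suc m"] x by simp
      qed (use \<kappa> in simp)
      also have "\<dots> = 2 * (\<kappa> * c) / 2 ^ m" by simp
      also have "\<dots> \<le> c3 / 2 ^ m" by (intro divide_right_mono le_c3) simp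
      finally have "\<rho> (p m x) (p (Suc m) x) \<le> c3 / 2 ^ m" .
      then have "cmod (f N (p m x) - f N (p (Suc m) x)) \<le> E * G m"
        using p[of x] x p_ball[OF x] step.hyps j by (intro near) auto
      moreover have "cmod (f N (p j x) - f N (p (Suc m) x))
          \<le> cmod (f N (p j x) - f N (p m x)) + cmod (f N (p m x) - f N (p (Suc m) x))"
        using norm_triangle_ineq[of "f N (p j x) - f N (p m x)" "f N (p m x) - f N (p (Suc m) x)"] by simp
      ultimately show ?case
        using step.IH step.hyps by (simp add: distrib_left)
    qed simp
    have tele': "cmod (f N (p j x) - f N (p m x)) \<le> E * C2 * G j" if "j \<le> m" for m
    proof -
      have "E * (\<Sum>k\<in>{j..<m}. G k) \<le> E * (C2 * G j)"
        unfolding G_def using E by (intro mult_left_mono C2(2)) auto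
      then show ?thesis using tele[OF that] by simp
    qed
    have "(\<lambda>m. c * (1 / 2) ^ m) \<longlonglongrightarrow> c * 0" by (intro tendsto_intros LIMSEQ_power_zero) simp
    then have lim: "(\<lambda>m. c / 2 ^ m) \<longlonglongrightarrow> 0" by (simp add: power_one_over)
    have "(\<lambda>m. dist (p m x) x) \<longlonglongrightarrow> 0"
      by (rule Lim_null_comparison[OF _ lim]) (use p[of x] x in \<open>simp add: dist_commute\<close>)
    then have "(\<lambda>m. p m x) \<longlonglongrightarrow> x" by (rule tendsto_dist_iff[THEN iffD2])
    then have "(\<lambda>m. f N (p m x)) \<longlonglongrightarrow> f N x"
      using x p[of x] D by (intro continuous_on_tendsto_compose[OF cont]) (auto intro!: always_eventually)
    then have "(\<lambda>m. cmod (f N (p j x) - f N (p m x))) \<longlonglongrightarrow> cmod (f N (p j x) - f N x)"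
      by (intro tendsto_intros)
    then show ?thesis by (rule LIMSEQ_le_const2) (use tele' in blast)
  qed
  have "cmod (f N x - f N y) \<le> (E * (2 * C2 + 1)) * G j"
    if j: "J' \<le> j" and x: "x \<in> cball x0 (\<gamma> / 2) \<inter> K" and y: "y \<in> cball x0 (\<gamma> / 2) \<inter> K"
      and xy: "\<rho> x y \<le> 1 / 2 ^ j" for j x y N
  proof -
    have "\<rho> (p j x) (p j y) \<le> \<kappa> * (\<rho> (p j x) x + \<rho> x (p j y))" by (rule tri)
    also have "\<dots> \<le> \<kappa> * (c / 2 ^ j + \<kappa> * (1 / 2 ^ j + c / 2 ^ j))"
    proof (intro mult_left_mono add_mono)
      show "\<rho> (p j x) x \<le> c / 2 ^ j" using p[of x j] x \<rho>_sym by simp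
      have "\<rho> x (p j y) \<le> \<kappa> * (\<rho> x y + \<rho> y (p j y))" by (rule tri)
      also have "\<dots> \<le> \<kappa> * (1 / 2 ^ j + c / 2 ^ j)"
        using p[of y j] y xy \<kappa> by (intro mult_left_mono add_mono) auto
      finally show "\<rho> x (p j y) \<le> \<kappa> * (1 / 2 ^ j + c / 2 ^ j)" .
    qed (use \<kappa> in simp)
    also have "\<dots> = (\<kappa> * c + \<kappa>\<^sup>2 * (1 + c)) / 2 ^ j"
      by (simp add: field_simps power2_eq_square)
    also have "\<dots> \<le> c3 / 2 ^ j" by (intro divide_right_mono le_c3) simp
    finally have "cmod (f N (p j x) - f N (p j y)) \<le> E * G j"
      using p[of x j] p[of y j] x y p_ball[OF x j] p_ball[OF y j] by (intro near[OF j]) auto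
    moreover have "cmod (f N x - f N y)
        \<le> cmod (f N (p j x) - f N (p j y)) + cmod (f N (p j x) - f N x) + cmod (f N (p j y) - f N y)"
      using norm_triangle_ineq[of "(f N (p j x) - f N (p j y)) - (f N (p j x) - f N x)" "f N (p j y) - f N y"]
        norm_triangle_ineq4[of "f N (p j x) - f N (p j y)" "f N (p j x) - f N x"] by simp
    ultimately show ?thesis
      using link[OF x j, of N] link[OF y j, of N] by (simp add: algebra_simps)
  qed
  moreover have "0 < E * (2 * C2 + 1)" using E C2(1) by simp
  ultimately show ?thesis unfolding G_def b_def by (rule that[rotated])
qed

text \<open>Continuity of \<open>\<rho>\<close> at \<open>(x0, x0)\<close> makes \<open>\<rho>\<close> small on a small ball, so every pair of its points has a
dyadic scale to which the chaining bound applies. That bound also says that the \<open>f N\<close> are uniformly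
equicontinuous with respect to \<open>\<rho>\<close>; together with convergence on each finite net this makes the
sequence uniformly Cauchy.\<close>
lemma local_modulus_and_uniform_convergence:
  fixes f :: "nat \<Rightarrow> 'b::metric_space \<Rightarrow> complex"
  assumes qm: "quasi_metric \<rho>"
    and D: "\<And>k. D k \<subseteq> K" and fin: "\<And>k. finite (D k)"
    and net: "\<And>k x. x \<in> K \<Longrightarrow> \<exists>y\<in>D k. \<rho> x y \<le> c / 2 ^ k \<and> dist x y \<le> c / 2 ^ k"
    and cont: "\<And>N. continuous_on K (f N)"
    and pos: "0 < c" "0 < \<beta>" "0 < \<gamma>" "0 < A" "0 < C0"
    and s_le: "\<And>x y. x \<in> cball x0 \<gamma> \<inter> K \<Longrightarrow> y \<in> cball x0 \<gamma> \<inter> K \<Longrightarrow> 0 < \<rho> x y \<Longrightarrow> \<rho> x y < 1 \<Longrightarrow>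
      s x y \<le> C0 * (\<rho> x y powr \<beta> * \<bar>ln (\<rho> x y)\<bar> powr \<eta>)"
    and incr: "\<And>k x y N. J \<le> k \<Longrightarrow> x \<in> D k \<union> D (Suc k) \<Longrightarrow> y \<in> D k \<union> D (Suc k) \<Longrightarrow>
      cmod (f N x - f N y) \<le> A * sqrt (real k + 1) * s x y"
    and Cau: "\<And>k x. x \<in> D k \<Longrightarrow> Cauchy (\<lambda>N. f N x)"
  obtains \<gamma>' C where "0 < \<gamma>'" "\<gamma>' < \<gamma>" "\<gamma>' < 1" "0 < C"
    "\<And>x y N. x \<in> cball x0 \<gamma>' \<inter> K \<Longrightarrow> y \<in> cball x0 \<gamma>' \<inter> K \<Longrightarrow>
      ereal (cmod (f N x - f N y)) \<le> ereal C * pow_log \<beta> (\<eta> + 1 / 2) (\<rho> x y)"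
    "uniformly_convergent_on (cball x0 \<gamma>' \<inter> K) f"
proof -
  have \<rho>_nonneg: "0 \<le> \<rho> x y" and \<rho>_eq_0: "\<rho> x y = 0 \<longleftrightarrow> x = y" for x y
    using qm by (auto simp: quasi_metric_def)
  obtain C1 J' where C1: "0 < C1"
    and modulus: "\<And>j x y N. J' \<le> j \<Longrightarrow> x \<in> cball x0 (\<gamma> / 2) \<inter> K \<Longrightarrow> y \<in> cball x0 (\<gamma> / 2) \<inter> K \<Longrightarrow>
      \<rho> x y \<le> 1 / 2 ^ j \<Longrightarrow> cmod (f N x - f N y) \<le> C1 * dyadic_gauge (\<beta> * ln 2) (\<eta> + 1 / 2) j"
    using chaining_modulus[where f = f and s = s and D = D and \<rho> = \<rho>, OF qm D net cont pos s_le incr]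
    by blast
  define G where "G = dyadic_gauge (\<beta> * ln 2) (\<eta> + 1 / 2)"
  obtain C2 where C2: "0 < C2"
    and gauge: "\<And>j h. 1 \<le> j \<Longrightarrow> 1 / 2 ^ Suc j < h \<Longrightarrow> h \<le> 1 / 2 ^ j \<Longrightarrow>
       G j \<le> C2 * (h powr \<beta> * \<bar>ln h\<bar> powr (\<eta> + 1 / 2))"
    using dyadic_gauge_le_pow_log[OF pos(2), of "\<eta> + 1 / 2"] unfolding G_def by blast
  \<comment> \<open>At least \<open>1\<close>, so that \<open>\<rho>\<close> stays below \<open>1\<close> on the ball, away from the exceptional value of \<open>pow_log\<close>.\<close>
  define J1 where "J1 = max J' 1"
  have J1: "J' \<le> J1" "1 \<le> J1" by (auto simp: J1_def)
  obtain r where r: "0 < r" and small: "\<And>x y. dist x x0 < r \<Longrightarrow> dist y x0 < r \<Longrightarrow> \<rho> x y < 1 / 2 ^ J1"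
  proof -
    let ?h = "\<lambda>p. \<rho> (fst p) (snd p)"
    have "isCont ?h (x0, x0)"
      using qm by (auto simp: quasi_metric_def case_prod_unfold continuous_on_eq_continuous_at)
    then have "(?h \<longlongrightarrow> ?h (x0, x0)) (nhds (x0, x0))"
      using tendsto_at_iff_tendsto_nhds[of ?h "(x0, x0)"] unfolding isCont_def by blast
    then have "eventually (\<lambda>p. ?h p < 1 / 2 ^ J1) (nhds x0 \<times>\<^sub>F nhds x0)"
      unfolding nhds_prod by (rule order_tendstoD(2)) (use \<rho>_eq_0[of x0 x0] in simp)
    then obtain P Q where "eventually P (nhds x0)" "eventually Q (nhds x0)"
      "\<And>x y. P x \<Longrightarrow> Q y \<Longrightarrow> \<rho> x y < 1 / 2 ^ J1"
      unfolding eventually_prod_filter by auto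
    moreover from this obtain r1 r2 where "0 < r1" "\<And>x. dist x x0 < r1 \<Longrightarrow> P x"
      "0 < r2" "\<And>x. dist x x0 < r2 \<Longrightarrow> Q x"
      unfolding eventually_nhds_metric by blast
    ultimately show ?thesis using that[of "min r1 r2"] by simp
  qed
  define \<gamma>' where "\<gamma>' = min (\<gamma> / 4) (min (r / 2) (1 / 2))"
  have \<gamma>': "0 < \<gamma>'" "\<gamma>' \<le> \<gamma> / 4" "\<gamma>' < r" "\<gamma>' < 1" using pos r by (auto simp: \<gamma>'_def)
  have sub: "cball x0 \<gamma>' \<subseteq> cball x0 (\<gamma> / 2)" using \<gamma>' pos by (intro subset_cball) auto
  have bound: "ereal (cmod (f N x - f N y)) \<le> ereal (C1 * C2) * pow_log \<beta> (\<eta> + 1 / 2) (\<rho> x y)"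
    if x: "x \<in> cball x0 \<gamma>' \<inter> K" and y: "y \<in> cball x0 \<gamma>' \<inter> K" for x y N
  proof (cases "x = y")
    case True
    then show ?thesis using \<rho>_eq_0[of x y] by (simp add: pow_log_def zero_ereal_def[symmetric])
  next
    case False
    then have h0: "0 < \<rho> x y" using \<rho>_nonneg[of x y] \<rho>_eq_0[of x y] by linarith
    have "\<rho> x y < 1 / 2 ^ J1" using x y \<gamma>' by (intro small) (auto simp: dist_commute)
    then have h1: "\<rho> x y \<le> 1 / 2 ^ J1" by simp
    obtain j where j: "J1 \<le> j" "1 / 2 ^ Suc j < \<rho> x y" "\<rho> x y \<le> 1 / 2 ^ j"
      using dyadic_scale_exists[OF h0 h1] by blast
    have "(1::real) / 2 ^ j \<le> 1 / 2 ^ 1" using j(1) J1 by (intro divide_left_mono power_increasing) auto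
    then have h2: "\<rho> x y < 1" using j(3) unfolding power_one_right by linarith
    have "cmod (f N x - f N y) \<le> C1 * G j"
      unfolding G_def using x y sub j J1 by (intro modulus) auto
    also have "\<dots> \<le> C1 * (C2 * (\<rho> x y powr \<beta> * \<bar>ln (\<rho> x y)\<bar> powr (\<eta> + 1 / 2)))"
      using C1 j J1 by (intro mult_left_mono gauge) auto
    finally show ?thesis using h0 h2 by (simp add: pow_log_def mult.assoc)
  qed
  have "uniformly_Cauchy_on (cball x0 \<gamma>' \<inter> K) f"
  proof (rule uniformly_Cauchy_onI)
    fix e :: real assume e: "0 < e"
    \<comment> \<open>A scale \<open>j\<close> at which the modulus is below \<open>e / 3\<close>, then a net fine enough for this scale; those of
        its points that approximate the small ball lie in the larger one, where the chaining bound holds.\<close>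
    have "(\<lambda>j. C1 * G j) \<longlonglongrightarrow> C1 * 0"
      unfolding G_def using pos by (intro tendsto_intros dyadic_gauge_tendsto_0) simp
    then have "eventually (\<lambda>j. C1 * G j < e / 3) sequentially"
      using e by (intro order_tendstoD(2)[of _ "C1 * 0"]) auto
    then have "eventually (\<lambda>j. C1 * G j < e / 3 \<and> J' \<le> j) sequentially"
      using eventually_ge_at_top by (rule eventually_conj)
    then obtain j where j: "C1 * G j < e / 3" "J' \<le> j" unfolding eventually_sequentially by blast
    have "(\<lambda>k. c * (1 / 2) ^ k) \<longlonglongrightarrow> c * 0" by (intro tendsto_intros LIMSEQ_power_zero) simp
    then have "eventually (\<lambda>k. c * (1 / 2) ^ k < min (1 / 2 ^ j) (\<gamma> / 4)) sequentially"
      using pos by (intro order_tendstoD(2)[of _ "c * 0"]) auto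
    then obtain k where "c * (1 / 2) ^ k < min (1 / 2 ^ j) (\<gamma> / 4)"
      unfolding eventually_sequentially by blast
    then have k: "c / 2 ^ k < 1 / 2 ^ j" "c / 2 ^ k < \<gamma> / 4"
      unfolding power_one_over min_less_iff_conj by simp_all
    have "\<forall>y\<in>D k. \<exists>n. \<forall>m\<ge>n. \<forall>l\<ge>n. dist (f m y) (f l y) < e / 3"
      using Cau e unfolding Cauchy_def by (meson divide_pos_pos zero_less_numeral)
    then obtain n where n: "\<And>y m l. y \<in> D k \<Longrightarrow> n y \<le> m \<Longrightarrow> n y \<le> l \<Longrightarrow> dist (f m y) (f l y) < e / 3"
      by metis
    have "dist (f m x) (f l x) < e"
      if x: "x \<in> cball x0 \<gamma>' \<inter> K" and ml: "sum n (D k) \<le> m" "sum n (D k) \<le> l" for x m l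
    proof -
      obtain y where y: "y \<in> D k" "\<rho> x y \<le> c / 2 ^ k" "dist x y \<le> c / 2 ^ k" using net x by blast
      have "n y \<le> sum n (D k)" by (rule member_le_sum) (use y fin in auto)
      then have 1: "dist (f m y) (f l y) < e / 3" using n y ml by (meson order_trans)
      have "dist x0 y \<le> dist x0 x + dist x y" by (rule dist_triangle)
      also have "dist x0 x \<le> \<gamma> / 4" using x \<gamma>'(2) by simp
      also have "dist x y \<le> \<gamma> / 4" using y(3) k(2) by linarith
      finally have y': "y \<in> cball x0 (\<gamma> / 2) \<inter> K" using y D by auto
      have x': "x \<in> cball x0 (\<gamma> / 2) \<inter> K" using x sub by auto
      have "\<rho> x y \<le> 1 / 2 ^ j" using y(2) k(1) by linarith
      from modulus[OF j(2) x' y' this] have 2: "dist (f i x) (f i y) < e / 3" for i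
        using j(1) unfolding G_def dist_norm by (meson order_le_less_trans)
      show ?thesis
        using 1 2[of m] 2[of l] dist_triangle[of "f m x" "f l x" "f m y"]
          dist_triangle2[of "f m y" "f l x" "f l y"] by linarith
    qed
    then show "\<exists>M. \<forall>x\<in>cball x0 \<gamma>' \<inter> K. \<forall>m\<ge>M. \<forall>n\<ge>M. dist (f m x) (f n x) < e" by blast
  qed
  then have unif: "uniformly_convergent_on (cball x0 \<gamma>' \<inter> K) f" by (rule Cauchy_uniformly_convergent)
  have "\<gamma>' < \<gamma>" using \<gamma>' pos by simp
  moreover have "0 < C1 * C2" using C1 C2 by simp
  ultimately show ?thesis using \<gamma>' bound unif by (intro that[of \<gamma>' "C1 * C2"])
qed

section \<open>Random coefficients\<close>

lemma summable_norm_diff_square: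
  fixes u v :: "nat \<Rightarrow> complex"
  assumes "summable (\<lambda>n. (cmod (u n))\<^sup>2)" "summable (\<lambda>n. (cmod (v n))\<^sup>2)"
  shows "summable (\<lambda>n. (cmod (u n - v n))\<^sup>2)"
proof (rule summable_comparison_test')
  show "summable (\<lambda>n. 2 * (cmod (u n))\<^sup>2 + 2 * (cmod (v n))\<^sup>2)"
    by (intro summable_add summable_mult assms)
  show "norm ((cmod (u n - v n))\<^sup>2) \<le> 2 * (cmod (u n))\<^sup>2 + 2 * (cmod (v n))\<^sup>2" for n
  proof -
    have "(cmod (u n - v n))\<^sup>2 \<le> (cmod (u n) + cmod (v n))\<^sup>2"
      by (intro power_mono norm_triangle_ineq4) simp
    also have "\<dots> \<le> 2 * (cmod (u n))\<^sup>2 + 2 * (cmod (v n))\<^sup>2"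
      using zero_le_power2[of "cmod (u n) - cmod (v n)"] by (simp add: power2_eq_square algebra_simps)
    finally show ?thesis by simp
  qed
qed

text \<open>The only probabilistic information that enters the chaining argument. It is stated in terms of the
coefficients and of the sequence \<open>h\<close> alone: no exponent, radius or constant of the modulus of
continuity occurs, so these may depend on \<open>h\<close> in an arbitrary way.\<close>
definition controlled_increments ::
    "(nat \<Rightarrow> 'b set) \<Rightarrow> real \<Rightarrow> (nat \<Rightarrow> 'b \<Rightarrow> complex) \<Rightarrow> (nat \<Rightarrow> complex) \<Rightarrow> bool" where
  "controlled_increments D A w h \<longleftrightarrow>
     (\<forall>k. \<forall>x\<in>D k. Cauchy (\<lambda>N. \<Sum>n<N. w n x * h n)) \<and>
     (\<exists>J. \<forall>k\<ge>J. \<forall>x\<in>D k. \<forall>y\<in>D k. \<forall>N.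
        (cmod (\<Sum>n<N. (w n x - w n y) * h n))\<^sup>2 \<le> A * Suc k * (\<Sum>n. (cmod (w n x - w n y))\<^sup>2))"

text \<open>By independence it suffices to treat the fields as fixed square-summable coefficients, for which
convergence and the Borel-Cantelli bound are known.\<close>
lemma (in prob_space) AE_controlled_increments:
  fixes W :: "nat \<Rightarrow> 'b \<Rightarrow> 'a \<Rightarrow> complex" and D :: "nat \<Rightarrow> 'b set"
  assumes ind: "indep_sequences M K g W"
    and indg: "indep_vars (\<lambda>_. borel) g UNIV"
    and sub: "\<And>n. sub_gaussian M 1 (g n)"
    and W: "\<And>n x. x \<in> K \<Longrightarrow> W n x \<in> borel_measurable M"
    and W_l2: "\<And>x. x \<in> K \<Longrightarrow> AE \<omega> in M. summable (\<lambda>n. (cmod (W n x \<omega>))\<^sup>2)"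
    and fin: "\<And>k. finite (D k)" and D: "\<And>k. D k \<subseteq> K"
    and card: "\<And>k. real (card (D k)) \<le> B ^ Suc k" and B: "1 \<le> B"
  shows "AE \<omega> in M. controlled_increments D (4 + 8 * ln B) (\<lambda>n x. W n x \<omega>) (\<lambda>n. g n \<omega>)"
proof (rule AE_indep_sequences[OF ind _ W])
  show "g n \<in> borel_measurable M" for n using indg by (auto simp: indep_vars_def)
  fix F :: "'a measure"
  assume W_F: "\<And>n x. x \<in> K \<Longrightarrow> W n x \<in> borel_measurable F"
  let ?S = "F \<Otimes>\<^sub>M PiM UNIV (\<lambda>_. borel :: complex measure)"
  have W_S: "(\<lambda>p. W n x (fst p)) \<in> borel_measurable ?S" if "x \<in> D k" for n k x
    using measurable_compose[OF measurable_fst W_F] that D by blast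
  have h_S [measurable]: "(\<lambda>p. snd p n) \<in> borel_measurable ?S" for n :: nat
    by (rule measurable_compose[OF measurable_snd measurable_component_singleton]) simp
  have C_pred: "Measurable.pred ?S (\<lambda>p. Cauchy (\<lambda>N. \<Sum>n<N. W n x (fst p) * snd p n))" if "x \<in> D k" for k x
  proof -
    note [measurable] = W_S[OF that]
    show ?thesis by measurable
  qed
  have I_pred: "Measurable.pred ?S (\<lambda>p. (cmod (\<Sum>n<N. (W n x (fst p) - W n y (fst p)) * snd p n))\<^sup>2
      \<le> (4 + 8 * ln B) * Suc k * (\<Sum>n. (cmod (W n x (fst p) - W n y (fst p)))\<^sup>2))"
    if "x \<in> D k" "y \<in> D k" for k x y N
  proof -
    note [measurable] = W_S[OF that(1)] W_S[OF that(2)]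
    show ?thesis by measurable
  qed
  have "Measurable.pred ?S
      (\<lambda>p. controlled_increments D (4 + 8 * ln B) (\<lambda>n x. W n x (fst p)) (snd p))"
    unfolding controlled_increments_def
    by (intro pred_intros_logic(3) pred_intros_countable(1,2) pred_intros_finite(3) pred_intros_imp' fin
        C_pred I_pred)
  then show "{p \<in> space ?S. controlled_increments D (4 + 8 * ln B) (\<lambda>n x. W n x (fst p)) (snd p)}
      \<in> sets ?S"
    by (simp add: pred_def)
next
  have "AE w in M. \<forall>x\<in>D k. summable (\<lambda>n. (cmod (W n x w))\<^sup>2)" for k
    using W_l2 D fin by (intro AE_finite_allI) auto
  then have "AE w in M. \<forall>k. \<forall>x\<in>D k. summable (\<lambda>n. (cmod (W n x w))\<^sup>2)"
    by (simp add: AE_all_countable)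
  then show "AE w in M. AE \<omega> in M.
      controlled_increments D (4 + 8 * ln B) (\<lambda>n x. W n x w) (\<lambda>n. g n \<omega>)"
  proof eventually_elim
    case (elim w)
    note l2 = this
    have "AE \<omega> in M. \<forall>x\<in>D k. Cauchy (\<lambda>N. \<Sum>n<N. W n x w * g n \<omega>)" for k
      using l2 fin by (intro AE_finite_allI sub_gaussian_series_Cauchy indg sub) auto
    then have 1: "AE \<omega> in M. \<forall>k. \<forall>x\<in>D k. Cauchy (\<lambda>N. \<Sum>n<N. W n x w * g n \<omega>)"
      by (simp add: AE_all_countable)
    have 2: "AE \<omega> in M. eventually (\<lambda>k. \<forall>x\<in>D k. \<forall>y\<in>D k. \<forall>N.
      (cmod (\<Sum>n<N. (W n x w - W n y w) * g n \<omega>))\<^sup>2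
        \<le> (4 + 8 * ln B) * Suc k * (\<Sum>n. (cmod (W n x w - W n y w))\<^sup>2)) sequentially"
      by (rule sub_gaussian_increments_eventually[OF indg sub fin card B])
         (use l2 in \<open>auto intro!: summable_norm_diff_square\<close>)
    show ?case
      using 1 2 unfolding controlled_increments_def eventually_sequentially
      by eventually_elim blast
  qed
qed

theorem theorem3p1:
  fixes M :: "'a measure"
    and a b x0 :: "real ^ 'd"
    and K :: "(real ^ 'd) set"
    and g :: "nat \<Rightarrow> 'a \<Rightarrow> complex"
    and W :: "nat \<Rightarrow> real ^ 'd \<Rightarrow> 'a \<Rightarrow> complex"
    and \<rho> :: "real ^ 'd \<Rightarrow> real ^ 'd \<Rightarrow> real"
    and \<Omega>' :: "'a set"
    and \<gamma> \<beta> \<eta> C0 :: "'a \<Rightarrow> real"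
  assumes "prob_space M"
    and "K = cbox a b" and "x0 \<in> K"
    and "indep_sequences M K g W"
    and "prob_space.indep_vars M (\<lambda>_. borel) g UNIV"
    and "\<And>n. symmetric_rv M (g n)"
    and "\<And>n. sub_gaussian M 1 (g n)"
    and "\<And>n. continuous_random_field M K (W n)"
    and "\<And>x. x \<in> K \<Longrightarrow> AE \<omega> in M. summable (\<lambda>n. (cmod (W n x \<omega>))\<^sup>2)"
    and "quasi_metric \<rho>"
    and "\<exists>H1 H2 c1 c2. 0 < H1 \<and> H1 \<le> H2 \<and> H2 \<le> 1 \<and> 0 < c1 \<and> 0 < c2 \<and>
           (\<forall>x y. norm (x - y) \<le> 1 \<longrightarrow>
              c1 * norm (x - y) powr H2 \<le> \<rho> x y \<and> \<rho> x y \<le> c2 * norm (x - y) powr H1)"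
    and "\<Omega>' \<in> sets M" and "measure M \<Omega>' = 1"
    and "\<gamma> \<in> borel_measurable M" and "\<And>\<omega>. \<omega> \<in> space M \<Longrightarrow> 0 < \<gamma> \<omega>"
    and "\<beta> \<in> borel_measurable M" and "\<And>\<omega>. \<omega> \<in> space M \<Longrightarrow> 0 < \<beta> \<omega> \<and> \<beta> \<omega> \<le> 1"
    and "\<eta> \<in> borel_measurable M"
    and "C0 \<in> borel_measurable M" and "\<And>\<omega>. \<omega> \<in> space M \<Longrightarrow> 0 < C0 \<omega>"
    and "\<And>\<omega> x y. \<omega> \<in> \<Omega>' \<Longrightarrow> x \<in> cball x0 (\<gamma> \<omega>) \<inter> K \<Longrightarrow> y \<in> cball x0 (\<gamma> \<omega>) \<inter> K \<Longrightarrow>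
           s_dist W x y \<omega> \<le> ereal (C0 \<omega>) * pow_log (\<beta> \<omega>) (\<eta> \<omega>) (\<rho> x y)"
  shows "AE \<omega> in M.
           (\<exists>\<gamma>'. 0 < \<gamma>' \<and> \<gamma>' < \<gamma> \<omega> \<and>
              (\<exists>C>0. \<forall>x\<in>cball x0 \<gamma>' \<inter> K. \<forall>y\<in>cball x0 \<gamma>' \<inter> K.
                 (SUP N. ereal (cmod (partial_sum W g N x \<omega> - partial_sum W g N y \<omega>)))
                   \<le> ereal C * pow_log (\<beta> \<omega>) (\<eta> \<omega> + 1 / 2) (\<rho> x y)) \<and>
              uniform_limit (cball x0 \<gamma>' \<inter> K)
                (\<lambda>N x. partial_sum W g N x \<omega>) (\<lambda>x. series_sum W g x \<omega>) sequentially) \<and>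
           (\<lambda>x. series_sum W g x \<omega>) \<in> holder_class \<rho> K x0 (\<beta> \<omega>) (\<eta> \<omega> + 1 / 2) \<and>
           continuous (at x0 within K) (\<lambda>x. series_sum W g x \<omega>)"
proof -
  interpret prob_space M by fact
  obtain H c2 where H: "0 < H" and c2: "0 < c2"
    and \<rho>_le: "\<And>x y. norm (x - y) \<le> 1 \<Longrightarrow> \<rho> x y \<le> c2 * norm (x - y) powr H"
    using assms(11) by blast
  have "bounded K" using assms(2) by simp
  then obtain D B c where fin: "\<And>k. finite (D k)" and D: "\<And>k. D k \<subseteq> K"
    and card: "\<And>k. real (card (D k)) \<le> B ^ Suc k" and B: "1 \<le> B" and c: "0 < c"
    and net: "\<And>k x. x \<in> K \<Longrightarrow> \<exists>y\<in>D k. \<rho> x y \<le> c / 2 ^ k \<and> dist x y \<le> c / 2 ^ k"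
    using exponential_nets[OF _ H c2 \<rho>_le] by blast
  \<comment> \<open>A link joins net points of the same level or of consecutive levels.\<close>
  define E where "E k = D k \<union> D (Suc k)" for k
  define B' where "B' = 2 * B * B"
  have B': "1 \<le> B'" using mult_mono[of 1 B 1 B] B by (simp add: B'_def)
  have card_E: "real (card (E k)) \<le> B' ^ Suc k" for k
  proof -
    have "real (card (E k)) \<le> real (card (D k)) + real (card (D (Suc k)))"
      unfolding E_def using card_Un_le[of "D k" "D (Suc k)"] by linarith
    also have "\<dots> \<le> B ^ Suc k + B ^ Suc (Suc k)" by (intro add_mono card)
    also have "\<dots> \<le> (2 * B) * B ^ Suc k"
      using B by (simp add: mult_right_mono flip: distrib_right)
    also have "\<dots> \<le> (2 * B) ^ Suc k * B ^ Suc k"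
      using B by (intro mult_right_mono self_le_power) auto
    also have "\<dots> = B' ^ Suc k" by (simp only: B'_def power_mult_distrib)
    finally show ?thesis .
  qed
  define A where "A = 4 + 8 * ln B'"
  have A: "0 < A" using ln_ge_zero[OF B'] unfolding A_def by linarith
  have W_cont: "AE \<omega> in M. \<forall>n. continuous_on K (\<lambda>x. W n x \<omega>)"
    using assms(8) by (simp add: AE_all_countable continuous_random_field_def)
  have W_meas: "W n x \<in> borel_measurable M" if "x \<in> K" for n x
    using assms(8) that by (simp add: continuous_random_field_def)
  have "AE \<omega> in M. controlled_increments E A (\<lambda>n x. W n x \<omega>) (\<lambda>n. g n \<omega>)"
    unfolding A_def
    by (rule AE_controlled_increments[OF assms(4,5,7) W_meas assms(9) _ _ card_E B'])
       (use fin D in \<open>auto simp: E_def\<close>)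
  moreover have "AE \<omega> in M. \<omega> \<in> \<Omega>'" using assms(13) by (rule AE_prob_1)
  ultimately show ?thesis using W_cont
  proof (eventually_elim)
    case (elim \<omega>)
    have \<omega>: "\<omega> \<in> space M" using elim(2) sets.sets_into_space[OF assms(12)] by blast
    define f where "f N x = partial_sum W g N x \<omega>" for N x
    define s where "s x y = sqrt (\<Sum>n. (cmod (W n x \<omega> - W n y \<omega>))\<^sup>2)" for x y
    obtain J where J: "\<And>k x y N. J \<le> k \<Longrightarrow> x \<in> E k \<Longrightarrow> y \<in> E k \<Longrightarrow>
        (cmod (\<Sum>n<N. (W n x \<omega> - W n y \<omega>) * g n \<omega>))\<^sup>2
          \<le> A * Suc k * (\<Sum>n. (cmod (W n x \<omega> - W n y \<omega>))\<^sup>2)"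
      and Cau: "\<And>k x. x \<in> E k \<Longrightarrow> Cauchy (\<lambda>N. \<Sum>n<N. W n x \<omega> * g n \<omega>)"
      using elim(1) unfolding controlled_increments_def by blast
    have cont: "continuous_on K (f N)" for N
      unfolding f_def partial_sum_def using elim(3) by (intro continuous_intros) auto
    \<comment> \<open>Here \<open>s_dist\<close> is bounded by a finite quantity, hence its series converges and it is equal to \<open>s\<close>.\<close>
    have s_le: "s x y \<le> C0 \<omega> * (\<rho> x y powr \<beta> \<omega> * \<bar>ln (\<rho> x y)\<bar> powr \<eta> \<omega>)"
      if "x \<in> cball x0 (\<gamma> \<omega>) \<inter> K" "y \<in> cball x0 (\<gamma> \<omega>) \<inter> K" "0 < \<rho> x y" "\<rho> x y < 1" for x y
      using assms(21)[OF elim(2) that(1,2)] that(3,4)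
      by (simp add: s_dist_def pow_log_def s_def split: if_splits)
    have incr: "cmod (f N x - f N y) \<le> sqrt A * sqrt (real k + 1) * s x y"
      if "J \<le> k" "x \<in> D k \<union> D (Suc k)" "y \<in> D k \<union> D (Suc k)" for k x y N
    proof -
      have "f N x - f N y = (\<Sum>n<N. (W n x \<omega> - W n y \<omega>) * g n \<omega>)"
        by (simp add: f_def partial_sum_def sum_subtractf left_diff_distrib)
      then have "(cmod (f N x - f N y))\<^sup>2 \<le> A * Suc k * (\<Sum>n. (cmod (W n x \<omega> - W n y \<omega>))\<^sup>2)"
        using J[of k x y N] that unfolding E_def by simp
      then have "cmod (f N x - f N y) \<le> sqrt (A * Suc k * (\<Sum>n. (cmod (W n x \<omega> - W n y \<omega>))\<^sup>2))"
        by (rule real_le_rsqrt)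
      then show ?thesis by (simp add: s_def real_sqrt_mult add.commute)
    qed
    have Cau': "Cauchy (\<lambda>N. f N x)" if "x \<in> D k" for k x
      using Cau[of x k] that by (simp add: f_def partial_sum_def E_def)
    obtain \<gamma>' C where \<gamma>': "0 < \<gamma>'" "\<gamma>' < \<gamma> \<omega>" "\<gamma>' < 1" and C: "0 < C"
      and bound: "\<And>x y N. x \<in> cball x0 \<gamma>' \<inter> K \<Longrightarrow> y \<in> cball x0 \<gamma>' \<inter> K \<Longrightarrow>
        ereal (cmod (f N x - f N y)) \<le> ereal C * pow_log (\<beta> \<omega>) (\<eta> \<omega> + 1 / 2) (\<rho> x y)"
      and unif: "uniformly_convergent_on (cball x0 \<gamma>' \<inter> K) f"
    proof (rule local_modulus_and_uniform_convergence[where f = f and s = s and D = D and \<rho> = \<rho>,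
          OF assms(10) D fin net cont c _ _ _ _ s_le incr Cau'])
      show "0 < \<beta> \<omega>" "0 < \<gamma> \<omega>" "0 < sqrt A" "0 < C0 \<omega>"
        using assms(15,17,20)[OF \<omega>] A by auto
    qed blast+
    define X where "X = cball x0 \<gamma>' \<inter> K"
    let ?S = "\<lambda>x. series_sum W g x \<omega>"
    have "uniform_limit X f (\<lambda>x. lim (\<lambda>N. f N x)) sequentially"
      using unif unfolding X_def uniformly_convergent_uniform_limit_iff .
    moreover have conv: "convergent (\<lambda>N. f N x)" if "x \<in> X" for x
      using unif that unfolding X_def by (rule uniformly_convergent_imp_convergent)
    then have S_eq: "?S x = lim (\<lambda>N. f N x)" if "x \<in> X" for x
      using that by (simp add: series_sum_def f_def)
    ultimately have lim: "uniform_limit X f ?S sequentially"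
      by (simp cong: uniform_limit_cong')
    have S_bound: "ereal (cmod (?S x - ?S y)) \<le> ereal C * pow_log (\<beta> \<omega>) (\<eta> \<omega> + 1 / 2) (\<rho> x y)"
      if "x \<in> X" "y \<in> X" for x y
    proof (rule LIMSEQ_le_const2)
      show "(\<lambda>N. ereal (cmod (f N x - f N y))) \<longlonglongrightarrow> ereal (cmod (?S x - ?S y))"
        using tendsto_uniform_limitI[OF lim] that by (intro tendsto_intros)
      show "\<exists>N. \<forall>n\<ge>N. ereal (cmod (f n x - f n y)) \<le> ereal C * pow_log (\<beta> \<omega>) (\<eta> \<omega> + 1 / 2) (\<rho> x y)"
        using bound that unfolding X_def by blast
    qed
    have "continuous_on X ?S"
      using cont by (intro uniform_limit_theorem[OF _ lim] always_eventually)
        (auto simp: X_def intro: continuous_on_subset)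
    moreover have "x0 \<in> X" using assms(3) \<gamma>' by (simp add: X_def)
    ultimately have "continuous (at x0 within X) ?S" by (simp add: continuous_on_eq_continuous_within)
    moreover have "at x0 within X = at x0 within K"
      unfolding X_def using \<gamma>'
      by (intro at_within_nhd[of _ "ball x0 \<gamma>'"]) auto
    ultimately have S_cont: "continuous (at x0 within K) ?S" by simp
    have S_holder: "?S \<in> holder_class \<rho> K x0 (\<beta> \<omega>) (\<eta> \<omega> + 1 / 2)"
      unfolding holder_class_def using \<gamma>' C S_bound unfolding X_def by blast
    have "\<forall>x\<in>X. \<forall>y\<in>X. (SUP N. ereal (cmod (f N x - f N y)))
        \<le> ereal C * pow_log (\<beta> \<omega>) (\<eta> \<omega> + 1 / 2) (\<rho> x y)"
      unfolding X_def using bound by (intro ballI SUP_least)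
    then show ?case
      using \<gamma>' C lim S_cont S_holder unfolding X_def f_def by blast
  qed
qed

end
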